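(* Let $p$ and $q$ be distinct positive odd integers with $\gcd(p,q) = 1$. For each positive integer $n$, let $m(n)$ denote the greatest integer $m \ge 1$ such that the grid graph $\square_m$ embeds into the leaper graph $\mathcal{L}_n$ of the $(p,q)$-leaper. Then there is a constant $C$, depending only on $p$ and $q$ (and not on $n$), such that $|m(n) - n/2| \le C$ for all positive integers $n$; i.e., $m(n) = n/2 + O_{p,q}(1)$.
   Context: Let $[n] = \{1, 2, \ldots, n\}$. The grid graph $\square_n$ has vertex set $[n]^2$, with $(x', y')$ and $(x'', y'')$ adjacent iff they are at Euclidean distance $1$. For positive integers $p \ne q$, the $(p,q)$-leaper graph $\mathcal{L}_n$ has vertex set $[n]^2$, with $(x', y')$ and $(x'', y'')$ adjacent iff $\{|x' - x''|, |y' - y''|\} = \{p, q\}$. A graph $G$ embeds into a graph $H$ if $G$ is isomorphic to a (not necessarily induced) subgraph of $H$. *)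

theory Defs
  imports "HOL-Analysis.Product_Vector" "Graph_Theory.Graph_Theory"
begin

text \<open>
  An undirected simple graph is a symmetric loop-free digraph without parallel arcs
  (\<^locale>\<open>pair_graph\<close>): an edge is the pair of its two orientations.
\<close>

definition board :: "nat \<Rightarrow> (int \<times> int) set" where
  "board n = {1..int n} \<times> {1..int n}"

text \<open>The distance on \<^typ>\<open>real \<times> real\<close> is the Euclidean one.\<close>

definition grid_graph :: "nat \<Rightarrow> (int \<times> int) pair_pre_digraph" where
  "grid_graph n = \<lparr> pverts = board n,
     parcs = {((x', y'), (x'', y'')). (x', y') \<in> board n \<and> (x'', y'') \<in> board n \<and>
       dist (real_of_int x', real_of_int y') (real_of_int x'', real_of_int y'') = 1} \<rparr>"

definition leaper_graph :: "int \<Rightarrow> int \<Rightarrow> nat \<Rightarrow> (int \<times> int) pair_pre_digraph" where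
  "leaper_graph p q n = \<lparr> pverts = board n,
     parcs = {((x', y'), (x'', y'')). (x', y') \<in> board n \<and> (x'', y'') \<in> board n \<and>
       {\<bar>x' - x''\<bar>, \<bar>y' - y''\<bar>} = {p, q}} \<rparr>"

text \<open>
  The subgraph need not be induced. It is not required to be symmetric, but this is
  automatic when \<open>G\<close> is symmetric, since it is isomorphic to \<open>G\<close>.
\<close>

definition embeds_into :: "'a pair_pre_digraph \<Rightarrow> 'b pair_pre_digraph \<Rightarrow> bool" where
  "embeds_into G H \<longleftrightarrow> (\<exists>K. subgraph K (with_proj H) \<and> digraph_iso (with_proj G) K)"

definition max_grid :: "int \<Rightarrow> int \<Rightarrow> nat \<Rightarrow> nat" where
  "max_grid p q n = (GREATEST m. m \<ge> 1 \<and> embeds_into (grid_graph m) (leaper_graph p q n))"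

lemma finite_board: "finite (board n)"
  by (simp add: board_def)

lemma card_board: "card (board n) = n * n"
  by (simp add: board_def card_cartesian_product)

lemma pair_graph_grid_graph: "pair_graph (grid_graph n)"
proof
  show "finite (parcs (grid_graph n))"
    by (rule finite_subset[of _ "board n \<times> board n"])
      (auto simp: grid_graph_def finite_board)
  show "symmetric (with_proj (grid_graph n))"
    by (auto simp: grid_graph_def symmetric_def sym_def dist_commute)
qed (auto simp: grid_graph_def finite_board)

lemma pair_graph_leaper_graph:
  assumes "0 < p" "0 < q"
  shows "pair_graph (leaper_graph p q n)"
proof
  show "finite (parcs (leaper_graph p q n))"
    by (rule finite_subset[of _ "board n \<times> board n"])
      (auto simp: leaper_graph_def finite_board)
  show "symmetric (with_proj (leaper_graph p q n))"
    by (auto simp: leaper_graph_def symmetric_def sym_def abs_minus_commute)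
qed (use assms in \<open>auto simp: leaper_graph_def finite_board doubleton_eq_iff\<close>)

lemma embeds_into_iff:
  assumes G: "pair_wf_digraph G" and H: "pair_wf_digraph H"
  shows "embeds_into G H \<longleftrightarrow>
    (\<exists>f. inj_on f (pverts G) \<and> f ` pverts G \<subseteq> pverts H \<and>
      (\<forall>(u, v) \<in> parcs G. (f u, f v) \<in> parcs H))"
    (is "?L \<longleftrightarrow> ?R")
proof
  assume ?L
  then obtain K h where K: "subgraph K (with_proj H)"
    and h: "pre_digraph.digraph_isomorphism (with_proj G) h" and Kh: "K = app_iso h (with_proj G)"
    by (auto simp: embeds_into_def digraph_iso_def)
  have ends: "iso_tail h = fst" "iso_head h = snd"
    using K Kh by (auto simp: subgraph_def compatible_def)
  have "(iso_verts h u, iso_verts h v) \<in> parcs H" if "(u, v) \<in> parcs G" for u v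
  proof -
    have "iso_arcs h (u, v) \<in> parcs H"
      using that K Kh by (auto simp: subgraph_def)
    moreover have "iso_arcs h (u, v) = (iso_verts h u, iso_verts h v)"
      using that h ends by (auto simp: pre_digraph.digraph_isomorphism_def prod_eq_iff)
    ultimately show ?thesis by simp
  qed
  moreover have "inj_on (iso_verts h) (pverts G)" "iso_verts h ` pverts G \<subseteq> pverts H"
    using h K Kh by (auto simp: pre_digraph.digraph_isomorphism_def subgraph_def)
  ultimately show ?R by (intro exI[of _ "iso_verts h"]) auto
next
  assume ?R
  then obtain f where f: "inj_on f (pverts G)" "f ` pverts G \<subseteq> pverts H"
    "\<And>u v. (u, v) \<in> parcs G \<Longrightarrow> (f u, f v) \<in> parcs H" by fast
  define h where "h = \<lparr> iso_verts = f, iso_arcs = map_prod f f, iso_head = snd, iso_tail = fst \<rparr>"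
  have arcs_verts: "u \<in> pverts G \<and> v \<in> pverts G" if "(u, v) \<in> parcs G" for u v
    using that G pair_wf_digraph.wellformed' by metis
  have "inj_on (map_prod f f) (parcs G)"
    using f(1) arcs_verts by (fastforce simp: inj_on_def)
  then have iso: "pre_digraph.digraph_isomorphism (with_proj G) h"
    using f(1) G by (auto simp: pre_digraph.digraph_isomorphism_def h_def wf_digraph_wp_iff)
  moreover have "wf_digraph (app_iso h (with_proj G))"
    using arcs_verts by unfold_locales (auto simp: h_def)
  then have "subgraph (app_iso h (with_proj G)) (with_proj H)"
    using f H by (auto simp: subgraph_def compatible_def wf_digraph_wp_iff h_def)
  ultimately show ?L by (auto simp: embeds_into_def digraph_iso_def)
qed

lemma embeds_into_grid_leaper_iff:
  "embeds_into (grid_graph m) (leaper_graph p q n) \<longleftrightarrow>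
    (\<exists>f. inj_on f (board m) \<and> f ` board m \<subseteq> board n \<and>
      (\<forall>(u, v) \<in> parcs (grid_graph m). (f u, f v) \<in> parcs (leaper_graph p q n)))"
proof -
  have "pair_wf_digraph (grid_graph m)" "pair_wf_digraph (leaper_graph p q n)"
    by (unfold_locales; auto simp: grid_graph_def leaper_graph_def)+
  from embeds_into_iff[OF this] show ?thesis
    by (simp add: grid_graph_def leaper_graph_def)
qed

lemma embeds_into_grid_leaper_le:
  assumes "embeds_into (grid_graph m) (leaper_graph p q n)"
  shows "m \<le> n"
proof -
  obtain f where "inj_on f (board m)" "f ` board m \<subseteq> board n"
    using assms by (auto simp: embeds_into_grid_leaper_iff)
  then have "m * m \<le> n * n"
    using card_inj_on_le[OF _ _ finite_board] by (metis card_board)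
  then show ?thesis
    by (metis power2_eq_square power2_nat_le_eq_le)
qed

lemma max_grid_greatest:
  assumes "n \<ge> 1"
  shows "max_grid p q n \<ge> 1"
    and "embeds_into (grid_graph (max_grid p q n)) (leaper_graph p q n)"
    and "\<And>m. m \<ge> 1 \<Longrightarrow> embeds_into (grid_graph m) (leaper_graph p q n) \<Longrightarrow> m \<le> max_grid p q n"
proof -
  let ?P = "\<lambda>m. m \<ge> 1 \<and> embeds_into (grid_graph m) (leaper_graph p q n)"
  have "embeds_into (grid_graph 1) (leaper_graph p q n)"
    unfolding embeds_into_grid_leaper_iff
    using assms by (intro exI[of _ id]) (auto simp: board_def grid_graph_def)
  then have ex: "?P 1" by simp
  have bound: "\<And>m. ?P m \<Longrightarrow> m \<le> n" using embeds_into_grid_leaper_le by blast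
  have "?P (max_grid p q n)"
    unfolding max_grid_def by (rule GreatestI_nat[where P = ?P, OF ex bound])
  then show "max_grid p q n \<ge> 1"
    and "embeds_into (grid_graph (max_grid p q n)) (leaper_graph p q n)" by auto
  show "m \<le> max_grid p q n"
    if "m \<ge> 1" "embeds_into (grid_graph m) (leaper_graph p q n)" for m
    unfolding max_grid_def using that by (intro Greatest_le_nat[where P = ?P, OF _ bound]) auto
qed

end

theory Submission
  imports Defs
begin

text \<open>
  All leaper moves have the same length, so every 4-cycle of the leaper graph is a parallelogram.
  Hence an embedding of the grid has the form \<open>f (i, j) = A i + B j\<close>, where \<open>A\<close> and \<open>B\<close> are leaper
  walks that use disjoint sets of the four directions \<open>(p, \<plusminus>q)\<close>, \<open>(q, \<plusminus>p)\<close>. A walk with a single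
  direction is straight and too long. Otherwise \<open>A\<close> and \<open>B\<close> use two directions each, spanning lattices
  of the same determinant \<open>2 N\<close> that both contain \<open>(N, N)\<close> and \<open>(N, -N)\<close>. By injectivity of \<open>f\<close>, neither
  of these vectors is a difference (a chord) of both walks.

  In lattice coordinates each walk is a path in the square grid, and Hopf's universal chord theorem
  applies: a path without the chord \<open>w\<close> has no chord \<open>k w\<close>, so it embeds into the cylinder modulo
  \<open>w\<close>. Counting points there shows that a walk with \<open>m\<close> points and without the chord \<open>(N, N)\<close>
  satisfies \<open>m \<le> E / 2 + O(1)\<close>, where \<open>E\<close> is the extent of \<open>x - y\<close> along it; likewise for
  \<open>(N, -N)\<close> and \<open>x + y\<close>. If one walk misses one vector and the other walk the other one, adding both
  estimates gives \<open>m \<le> n / 2 + O(1)\<close>. If one walk misses both vectors, then \<open>x - y\<close> and \<open>x + y\<close>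
  determine each other along it up to a bounded error, hence they are monotone in each other up to a
  bounded error, and their extents add up in a single coordinate.

  For the lower bound, \<open>A\<close> and \<open>B\<close> sweep strips of width \<open>(p + q) / 2\<close> in boustrophedon order, \<open>A\<close>
  along \<open>(p, -q)\<close> and \<open>B\<close> along \<open>(q, p)\<close>.
\<close>

subsection \<open>Crossing lattice walks\<close>

text \<open>Equality is allowed, so a walk may stand still; this lets \<open>straight_walk\<close>
  use a prescribed number of steps.\<close>

definition near :: "int \<times> int \<Rightarrow> int \<times> int \<Rightarrow> bool" where
  "near u v \<longleftrightarrow> \<bar>fst v - fst u\<bar> + \<bar>snd v - snd u\<bar> \<le> 1"

definition walk :: "(nat \<Rightarrow> int \<times> int) \<Rightarrow> nat \<Rightarrow> bool" where
  "walk V k \<longleftrightarrow> (\<forall>i<k. near (V i) (V (Suc i)))"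

definition edge_crossing :: "int \<times> int \<Rightarrow> int \<times> int \<Rightarrow> int \<Rightarrow> int \<Rightarrow> int" where
  "edge_crossing u v x y =
     (if fst u = fst v \<and> fst u < x then of_bool (y < snd v) - of_bool (y < snd u) else 0)"

text \<open>The signed number of times that the walk, extended by vertical rays downwards from its start
  and upwards from its end, crosses the leftward ray from \<open>(x, y + 1/2)\<close>.\<close>
definition crossings :: "(nat \<Rightarrow> int \<times> int) \<Rightarrow> nat \<Rightarrow> int \<Rightarrow> int \<Rightarrow> int" where
  "crossings V k x y = (\<Sum>i<k. edge_crossing (V i) (V (Suc i)) x y)
     + of_bool (fst (V k) < x \<and> snd (V k) \<le> y) + of_bool (fst (V 0) < x \<and> y < snd (V 0))"

lemma near_cases:
  assumes "near u v"
  obtains "v = u" | "v = (fst u + 1, snd u)" | "v = (fst u - 1, snd u)"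
    | "v = (fst u, snd u + 1)" | "v = (fst u, snd u - 1)"
proof -
  have "v = u \<or> v = (fst u + 1, snd u) \<or> v = (fst u - 1, snd u)
    \<or> v = (fst u, snd u + 1) \<or> v = (fst u, snd u - 1)"
    using assms unfolding near_def prod_eq_iff fst_conv snd_conv by arith
  then show ?thesis using that by blast
qed

lemma near_sym: "near u v \<Longrightarrow> near v u"
  by (simp add: near_def abs_minus_commute)

lemma edge_crossing_horizontal:
  assumes "near u v" "u \<noteq> (x, y)" "v \<noteq> (x, y)"
  shows "edge_crossing u v (x + 1) y = edge_crossing u v x y"
  using assms(1) by (rule near_cases) (use assms(2,3) in \<open>auto simp: edge_crossing_def prod_eq_iff\<close>)

lemma edge_crossing_vertical:
  assumes "near u v" "u \<noteq> (x, y + 1)" "v \<noteq> (x, y + 1)"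
  shows "edge_crossing u v x y = edge_crossing u v x (y + 1)
    + (of_bool (fst v < x \<and> snd v = y + 1) - of_bool (fst u < x \<and> snd u = y + 1))"
  using assms(1) by (rule near_cases) (use assms(2,3) in \<open>auto simp: edge_crossing_def prod_eq_iff\<close>)

text \<open>The longer ray gains one possible crossing, in column x. An edge crossing there has (x,
  y) as an endpoint, and the last two hypotheses keep the vertical end rays away.\<close>

lemma crossings_horizontal:
  assumes "walk V k" "\<And>i. i \<le> k \<Longrightarrow> V i \<noteq> (x, y)"
    "\<not> (fst (V k) = x \<and> snd (V k) < y)" "\<not> (fst (V 0) = x \<and> y < snd (V 0))"
  shows "crossings V k (x + 1) y = crossings V k x y"
proof -
  have "(\<Sum>i<k. edge_crossing (V i) (V (Suc i)) (x + 1) y)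
      = (\<Sum>i<k. edge_crossing (V i) (V (Suc i)) x y)"
    using assms(1,2) by (intro sum.cong edge_crossing_horizontal) (auto simp: walk_def)
  moreover have "V k \<noteq> (x, y)" using assms(2) by blast
  then have "fst (V k) < x + 1 \<and> snd (V k) \<le> y \<longleftrightarrow> fst (V k) < x \<and> snd (V k) \<le> y"
    using assms(3) by (cases "V k") auto
  moreover have "fst (V 0) < x + 1 \<and> y < snd (V 0) \<longleftrightarrow> fst (V 0) < x \<and> y < snd (V 0)"
    using assms(4) by auto
  ultimately show ?thesis by (simp only: crossings_def)
qed

text \<open>Only row y + 1 lies between the two rays. Edge by edge the count changes by the
  increment of the indicator \<open>R\<close> of being in that row left of x, because a horizontal
  step can change this indicator only through (x, y + 1). The increments telescope, and the end rays
  absorb the boundary terms.\<close>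

lemma crossings_vertical:
  assumes "walk V k" "\<And>i. i \<le> k \<Longrightarrow> V i \<noteq> (x, y + 1)"
  shows "crossings V k x (y + 1) = crossings V k x y"
proof -
  define R :: "nat \<Rightarrow> int" where "R i = of_bool (fst (V i) < x \<and> snd (V i) = y + 1)" for i
  have "(\<Sum>i<k. edge_crossing (V i) (V (Suc i)) x y)
      = (\<Sum>i<k. edge_crossing (V i) (V (Suc i)) x (y + 1) + (R (Suc i) - R i))"
    unfolding R_def using assms by (intro sum.cong edge_crossing_vertical) (auto simp: walk_def)
  also have "\<dots> = (\<Sum>i<k. edge_crossing (V i) (V (Suc i)) x (y + 1)) + (R k - R 0)"
    by (simp only: sum.distrib sum_lessThan_telescope)
  finally show ?thesis
    by (simp add: crossings_def R_def of_bool_def)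
qed

lemma crossings_left: 
  assumes "\<And>i. i \<le> k \<Longrightarrow> x \<le> fst (V i)"
  shows "crossings V k x y = 0"
proof -
  have "\<not> fst (V i) < x" if "i \<le> k" for i using assms that by (simp add: not_less)
  then have "(\<Sum>i<k. edge_crossing (V i) (V (Suc i)) x y) = 0"
    by (intro sum.neutral) (auto simp: edge_crossing_def)
  then show ?thesis using assms[of 0] assms[of k] by (simp add: crossings_def)
qed

text \<open>Now every edge counts. The extended walk rises from minus infinity to plus infinity, so
  in net it passes each height once.\<close>

lemma crossings_right:
  assumes "walk V k" "\<And>i. i \<le> k \<Longrightarrow> fst (V i) < x"
  shows "crossings V k x y = 1"
proof -
  define R :: "nat \<Rightarrow> int" where "R i = of_bool (y < snd (V i))" for i
  have "edge_crossing (V i) (V (Suc i)) x y = R (Suc i) - R i"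
    if "i < k" for i
  proof -
    have "near (V i) (V (Suc i))" using assms(1) that by (simp add: walk_def)
    then show ?thesis
      by (rule near_cases) (use assms(2)[of i] that in \<open>auto simp: edge_crossing_def R_def\<close>)
  qed
  then have "(\<Sum>i<k. edge_crossing (V i) (V (Suc i)) x y) = (\<Sum>i<k. R (Suc i) - R i)"
    by (intro sum.cong) auto
  also have "\<dots> = R k - R 0" by (simp only: sum_lessThan_telescope)
  finally show ?thesis
    using assms(2)[of 0] assms(2)[of k] by (simp add: crossings_def R_def of_bool_def)
qed

text \<open>A discrete Jordan argument: \<open>V\<close> with its two vertical rays separates left
  from right. If \<open>G\<close> avoided it, the crossing number would be constant along
  \<open>G\<close>, yet it is 0 far to the left and 1 far to the right.\<close>

lemma walks_meet:
  fixes G :: "int \<Rightarrow> int \<times> int"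
  assumes V: "walk V k"
    and G: "\<And>i. near (G i) (G (i + 1))"
    and left: "\<And>M. \<exists>i. fst (G i) \<le> M" and right: "\<And>M. \<exists>i. M \<le> fst (G i)"
    and top: "\<And>i. \<not> (fst (V k) = fst (G i) \<and> snd (V k) < snd (G i))"
    and bot: "\<And>i. \<not> (fst (V 0) = fst (G i) \<and> snd (G i) < snd (V 0))"
  shows "\<exists>i. \<exists>j\<le>k. G i = V j"
proof (rule ccontr)
  assume "\<not> ?thesis"
  then have ne: "V j \<noteq> G i" if "j \<le> k" for i j using that by metis
  define c where "c i = crossings V k (fst (G i)) (snd (G i))" for i
  have hor: "crossings V k (fst (G i) + 1) (snd (G i)) = c i" for i
    unfolding c_def using ne top bot by (intro crossings_horizontal V) auto
  have ver: "crossings V k (fst (G i)) (snd (G i)) = crossings V k (fst (G i)) (snd (G i) - 1)" for i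
    using ne crossings_vertical[OF V, of "fst (G i)" "snd (G i) - 1"] by auto
  have step: "c (i + 1) = c i" for i
    using G[of i]
  proof (cases rule: near_cases)
    case 1 then show ?thesis by (simp add: c_def)
  next
    case 2 then show ?thesis using hor[of i] by (simp add: c_def)
  next
    case 3 then show ?thesis using hor[of "i + 1"] by (simp add: c_def)
  next
    case 4 then show ?thesis using ver[of "i + 1"] by (simp add: c_def)
  next
    case 5 then show ?thesis using ver[of i] by (simp add: c_def)
  qed
  have const: "c i = c 0" for i
  proof (induction i rule: int_induct[where k = 0])
    case (step2 i) then show ?case using step[of "i - 1"] by simp
  qed (simp_all add: step)
  obtain i where i: "fst (G i) \<le> Min ((\<lambda>j. fst (V j)) ` {..k})" using left by blast
  have "c i = 0" unfolding c_def
  proof (rule crossings_left)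
    fix j assume "j \<le> k"
    then show "fst (G i) \<le> fst (V j)" by (intro order.trans[OF i] Min_le) auto
  qed
  moreover obtain i' where i': "Max ((\<lambda>j. fst (V j)) ` {..k}) + 1 \<le> fst (G i')" using right by blast
  have "c i' = 1" unfolding c_def
  proof (rule crossings_right[OF V])
    fix j assume "j \<le> k"
    then have "fst (V j) \<le> Max ((\<lambda>j. fst (V j)) ` {..k})" by (intro Max_ge) auto
    then show "fst (V j) < fst (G i')" using i' by linarith
  qed
  ultimately show False using const[of i] const[of i'] by simp
qed

section \<open>Periodic walks and their translates\<close>

lemma near_add: "near u v \<Longrightarrow> near (u + z) (v + z)"
  by (simp add: near_def)

lemma ex_minimal_index:
  fixes g :: "nat \<Rightarrow> int"
  shows "\<exists>i\<le>m. \<forall>t\<le>m. g i \<le> g t"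
proof (induction m)
  case (Suc m)
  then obtain i where "i \<le> m" "\<forall>t\<le>m. g i \<le> g t" by blast
  then show ?case
    by (cases "g i \<le> g (Suc m)")
      (fastforce simp: le_Suc_eq intro: exI[of _ i], fastforce simp: le_Suc_eq intro: exI[of _ "Suc m"])
qed simp

lemma ex_maximal_index:
  fixes g :: "nat \<Rightarrow> int"
  shows "\<exists>i\<le>m. \<forall>t\<le>m. g t \<le> g i"
  using ex_minimal_index[of m "\<lambda>t. - g t"] by simp

text \<open>The periodic extension \<open>G\<close> of \<open>b\<close> is unbounded on both sides.
  A piece of \<open>b\<close> between a minimum and a maximum of \<open>\<psi>\<close>, the
  coordinate across w, is translated by k w. This preserves \<open>\<psi>\<close>, so the vertical
  end rays of the piece miss \<open>G\<close> and \<open>walks_meet\<close> provides a common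
  point.\<close>

lemma periodic_walk_chord_pos:
  fixes b :: "nat \<Rightarrow> int \<times> int" and w1 w2 J k :: int
  assumes b: "walk b N" and per: "b N = b 0 + (J * w1, J * w2)" and "J \<noteq> 0" and "0 < w1"
  shows "\<exists>r\<le>N. \<exists>s\<le>N. \<exists>c. b r - b s = ((k + c * J) * w1, (k + c * J) * w2)"
proof -
  define \<psi> where "\<psi> u = w1 * snd u - w2 * fst u" for u :: "int \<times> int"
  have \<psi>_add: "\<psi> (u + (z * w1, z * w2)) = \<psi> u" for u z
    by (simp add: \<psi>_def algebra_simps)
  have "J * w1 \<noteq> 0" using assms(3,4) by simp
  then have "N \<noteq> 0" using per by (intro notI) (simp add: prod_eq_iff)
  define G where "G i = b (nat (i mod int N)) + (i div int N * J * w1, i div int N * J * w2)" for i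
  have G_near: "near (G i) (G (i + 1))" for i
  proof -
    have r: "nat (i mod int N) < N" using \<open>N \<noteq> 0\<close> by (simp add: nat_less_iff)
    have "G (i + 1) = b (Suc (nat (i mod int N))) + (i div int N * J * w1, i div int N * J * w2)"
    proof (cases "i mod int N + 1 = int N")
      case True
      have "i + 1 = i div int N * int N + (i mod int N + 1)" by simp
      also have "\<dots> = (i div int N + 1) * int N" unfolding True by (simp only: distrib_right mult_1)
      finally have "i + 1 = (i div int N + 1) * int N" .
      then have "(i + 1) mod int N = 0" "(i + 1) div int N = i div int N + 1"
        using \<open>N \<noteq> 0\<close> by (metis mod_mult_self2_is_0, metis nonzero_mult_div_cancel_right of_nat_eq_0_iff)
      moreover have "Suc (nat (i mod int N)) = N" using True r by linarith
      ultimately show ?thesis using per by (simp add: G_def algebra_simps)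
    next
      case False
      then have lt: "i mod int N + 1 < int N" using r by linarith
      have "0 \<le> i mod int N" using \<open>N \<noteq> 0\<close> by simp
      have i: "i + 1 = int N * (i div int N) + (i mod int N + 1)" by simp
      have "(i + 1) mod int N = i mod int N + 1" "(i + 1) div int N = i div int N"
        using int_mod_pos_eq[OF i _ lt] int_div_pos_eq[OF i _ lt] \<open>0 \<le> i mod int N\<close> by simp_all
      then show ?thesis using \<open>0 \<le> i mod int N\<close> by (simp add: G_def nat_add_distrib)
    qed
    moreover have "near (b (nat (i mod int N))) (b (Suc (nat (i mod int N))))"
      using b r by (simp add: walk_def)
    ultimately show ?thesis by (simp add: G_def near_add)
  qed
  have G_mult: "fst (G (z * int N)) = fst (b 0) + z * (J * w1)" for z
    using \<open>N \<noteq> 0\<close> by (simp add: G_def)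
  have unb: "\<exists>z. z * (J * w1) \<le> M" "\<exists>z. M \<le> z * (J * w1)" for M
  proof -
    have "\<exists>z. M \<le> z * (J * w1)" for M
    proof (intro exI)
      have "\<bar>M\<bar> * 1 \<le> \<bar>M\<bar> * \<bar>J * w1\<bar>" using \<open>J * w1 \<noteq> 0\<close> by (intro mult_left_mono) linarith+
      also have "\<dots> = \<bar>M\<bar> * sgn (J * w1) * (J * w1)" by (simp add: abs_sgn mult.assoc mult.commute)
      finally show "M \<le> \<bar>M\<bar> * sgn (J * w1) * (J * w1)" by simp
    qed
    then show "\<exists>z. M \<le> z * (J * w1)" for M .
    from this[of "- M"] obtain z where "- M \<le> z * (J * w1)" by blast
    then have "(- z) * (J * w1) \<le> M" by simp
    then show "\<exists>z. z * (J * w1) \<le> M" by blast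
  qed
  obtain lo hi where lohi: "lo \<le> N" "hi \<le> N"
    and lo: "\<forall>t\<le>N. \<psi> (b lo) \<le> \<psi> (b t)" and hi: "\<forall>t\<le>N. \<psi> (b t) \<le> \<psi> (b hi)"
    using ex_minimal_index[of N "\<lambda>t. \<psi> (b t)"] ex_maximal_index[of N "\<lambda>t. \<psi> (b t)"] by blast
  have ext: "\<psi> (b lo) \<le> \<psi> (G i)" "\<psi> (G i) \<le> \<psi> (b hi)" for i
  proof -
    have "nat (i mod int N) \<le> N" using \<open>N \<noteq> 0\<close>
      by (simp add: nat_le_iff) (metis of_nat_0_less_iff bot_nat_0.not_eq_extremum pos_mod_bound order_less_imp_le)
    then show "\<psi> (b lo) \<le> \<psi> (G i)" "\<psi> (G i) \<le> \<psi> (b hi)"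
      unfolding G_def \<psi>_add using lo hi by auto
  qed
  \<comment> \<open>The piece is traversed backwards if the maximum comes before the
    minimum.\<close>
  define g where "g t = (if lo \<le> hi then lo + t else lo - t)" for t
  define L where "L = (if lo \<le> hi then hi - lo else lo - hi)"
  have g: "g t \<le> N" if "t \<le> L" for t using that lohi by (auto simp: g_def L_def split: if_splits)
  define V where "V t = b (g t) + (k * w1, k * w2)" for t
  have "near (b (g t)) (b (g (Suc t)))" if "t < L" for t
  proof (cases "lo \<le> hi")
    case True
    then show ?thesis using that b lohi by (simp add: walk_def g_def L_def)
  next
    case False
    then have "near (b (lo - Suc t)) (b (Suc (lo - Suc t)))"
      using that b lohi unfolding walk_def L_def by simp
    moreover have "Suc (lo - Suc t) = lo - t" using that False by (simp add: L_def)
    ultimately show ?thesis using False by (simp add: g_def near_sym)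
  qed
  then have V: "walk V L" by (simp add: walk_def V_def near_add)
  have ends: "\<psi> (V 0) = \<psi> (b lo)" "\<psi> (V L) = \<psi> (b hi)"
    unfolding V_def \<psi>_add by (simp_all add: g_def L_def)
  \<comment> \<open>Above a maximum or below a minimum, a vertical ray leaves the range of
    \<open>\<psi>\<close> on \<open>G\<close>. This is where the sign of w1 matters.\<close>
  have mono: "\<psi> u < \<psi> v" if "fst u = fst v" "snd u < snd v" for u v
    using that \<open>0 < w1\<close> by (simp add: \<psi>_def)
  have "\<exists>i. \<exists>j\<le>L. G i = V j"
  proof (rule walks_meet[where G = G, OF V G_near])
    fix M
    obtain z where "z * (J * w1) \<le> M - fst (b 0)" using unb(1) by blast
    then have "fst (G (z * int N)) \<le> M" unfolding G_mult by linarith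
    then show "\<exists>i. fst (G i) \<le> M" ..
    obtain z where "M - fst (b 0) \<le> z * (J * w1)" using unb(2) by blast
    then have "M \<le> fst (G (z * int N))" unfolding G_mult by linarith
    then show "\<exists>i. M \<le> fst (G i)" ..
  next
    fix i
    show "\<not> (fst (V L) = fst (G i) \<and> snd (V L) < snd (G i))"
      using mono[of "V L" "G i"] ext(2)[of i] ends(2) by auto
    show "\<not> (fst (V 0) = fst (G i) \<and> snd (G i) < snd (V 0))"
      using mono[of "G i" "V 0"] ext(1)[of i] ends(1) by auto
  qed
  then obtain i j where ij: "j \<le> L" "G i = V j" by blast
  have "nat (i mod int N) \<le> N" using \<open>N \<noteq> 0\<close>
    by (simp add: nat_le_iff) (metis of_nat_0_less_iff bot_nat_0.not_eq_extremum pos_mod_bound order_less_imp_le)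
  moreover have "b (nat (i mod int N)) - b (g j) = ((k + (- (i div int N)) * J) * w1, (k + (- (i div int N)) * J) * w2)"
    using ij(2) by (simp add: G_def V_def prod_eq_iff algebra_simps)
  ultimately show ?thesis using g[OF ij(1)] by blast
qed

lemma periodic_walk_chord:
  fixes b :: "nat \<Rightarrow> int \<times> int" and w1 w2 J k :: int
  assumes b: "walk b N" and per: "b N = b 0 + (J * w1, J * w2)" and "J \<noteq> 0" and "w1 \<noteq> 0"
  shows "\<exists>r\<le>N. \<exists>s\<le>N. \<exists>c. b r - b s = ((k + c * J) * w1, (k + c * J) * w2)"
proof (cases "0 < w1")
  case True
  then show ?thesis using periodic_walk_chord_pos assms by blast
next
  case False
  then have "\<exists>r\<le>N. \<exists>s\<le>N. \<exists>c. b r - b s = ((- k + c * (- J)) * (- w1), (- k + c * (- J)) * (- w2))"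
    using assms by (intro periodic_walk_chord_pos) auto
  moreover have "(- k + c * (- J)) * (- v) = (k + c * J) * v" for c v by (simp add: algebra_simps)
  ultimately show ?thesis by simp
qed

subsection \<open>Universal chords\<close>

definition chord :: "(nat \<Rightarrow> int \<times> int) \<Rightarrow> nat \<Rightarrow> int \<times> int \<Rightarrow> bool" where
  "chord V m w \<longleftrightarrow> (\<exists>i\<le>m. \<exists>j\<le>m. V j - V i = w)"

lemma walk_subsegment:
  "walk V k \<Longrightarrow> i + l \<le> k \<Longrightarrow> walk (\<lambda>t. V (i + t)) l"
  by (simp add: walk_def)

text \<open>Hopf's universal chord theorem: a segment of minimal length among those that realise a nonzero
  multiple of \<open>w\<close> realises \<open>w\<close> or \<open>- w\<close>, since otherwise its periodic extension meets its
  translate by \<open>w\<close> in the ends of a shorter one.\<close>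
lemma universal_chord:
  assumes V: "walk V m" and "i < j" "j \<le> m" "V j - V i = (J * w1, J * w2)" "J \<noteq> 0" "w1 \<noteq> 0"
  shows "chord V m (w1, w2)"
  using assms(2-5)
proof (induction "j - i" arbitrary: i j J rule: less_induct)
  case less
  have "\<exists>r\<le>j - i. \<exists>s\<le>j - i. \<exists>c. V (i + r) - V (i + s) = ((1 + c * J) * w1, (1 + c * J) * w2)"
    using less.prems assms(6)
    by (intro periodic_walk_chord walk_subsegment[OF V]) (auto simp: algebra_simps prod_eq_iff)
  then obtain r s c where rs: "r \<le> j - i" "s \<le> j - i"
    and V_rs: "V (i + r) - V (i + s) = ((1 + c * J) * w1, (1 + c * J) * w2)" by blast
  show ?case
  proof (cases "J = 1 \<or> J = - 1")
    case True
    then have "V j - V i = (w1, w2) \<or> V i - V j = (w1, w2)"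
      using less.prems by (auto simp: prod_eq_iff)
    then show ?thesis using less.prems unfolding chord_def by (meson less_imp_le order.trans)
  next
    case False
    \<comment> \<open>J is not a unit, so 1 + c J, being 1 modulo J, differs from 0, J and -J. Hence
      r and s are distinct and are not the two ends of the segment: they bound a strictly shorter
      one.\<close>
    have n0: "1 + c * J \<noteq> 0"
    proof
      assume "1 + c * J = 0"
      then have "J * (- c) = 1" by (simp add: algebra_simps)
      then show False using False zmult_eq_1_iff by blast
    qed
    then have "r \<noteq> s" using V_rs assms(6) by (auto simp: prod_eq_iff)
    have nJ: "1 + c * J \<noteq> J" "1 + c * J \<noteq> - J"
    proof -
      have "J * (1 - c) \<noteq> 1" "J * (- 1 - c) \<noteq> 1" using False zmult_eq_1_iff by blast+
      then show "1 + c * J \<noteq> J" "1 + c * J \<noteq> - J" by (auto simp: algebra_simps)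
    qed
    show ?thesis
    proof (cases "s < r")
      case True
      have "\<not> (s = 0 \<and> r = j - i)"
        using V_rs nJ(1) less.prems assms(6) by (auto simp: prod_eq_iff)
      then show ?thesis
        using True rs less.prems V_rs n0 by (intro less.hyps[of "i + r" "i + s" "1 + c * J"]) auto
    next
      case False
      have "\<not> (r = 0 \<and> s = j - i)"
      proof
        assume "r = 0 \<and> s = j - i"
        then have "V i - V j = ((1 + c * J) * w1, (1 + c * J) * w2)" using V_rs less.prems by simp
        then have "(1 + c * J) * w1 = (- J) * w1" using less.prems by (simp add: prod_eq_iff)
        then show False using nJ(2) assms(6) by (metis mult_cancel_right)
      qed
      moreover have "V (i + s) - V (i + r) = ((- (1 + c * J)) * w1, (- (1 + c * J)) * w2)"
        using V_rs by (simp add: prod_eq_iff algebra_simps)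
      ultimately show ?thesis
        using False \<open>r \<noteq> s\<close> rs less.prems n0
        by (intro less.hyps[of "i + s" "i + r" "- (1 + c * J)"]) auto
    qed
  qed
qed

lemma chord_uminus: "chord V m (- w) \<longleftrightarrow> chord V m w"
proof -
  have "V j - V i = - w \<longleftrightarrow> V i - V j = w" for i j
    by (metis minus_diff_eq minus_minus)
  then show ?thesis unfolding chord_def by metis
qed

text \<open>The contrapositive of \<open>universal_chord\<close>, in either order of the indices.
  Hence an injective walk without the chord w stays injective modulo w.\<close>

lemma no_chord_multiple:
  assumes "walk V m" "\<not> chord V m (w1, w2)" "w1 \<noteq> 0" "i \<le> m" "j \<le> m"
    and J: "V j - V i = (J * w1, J * w2)"
  shows "J = 0"
proof (rule ccontr)
  assume "J \<noteq> 0"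
  consider "i < j" | "j < i" | "i = j" by linarith
  then show False
  proof cases
    case 1
    then show ?thesis using universal_chord[OF assms(1) 1 \<open>j \<le> m\<close> J \<open>J \<noteq> 0\<close>] assms by blast
  next
    case 2
    have "V i - V j = ((- J) * w1, (- J) * w2)" using J by (simp add: prod_eq_iff algebra_simps)
    from universal_chord[OF assms(1) 2 \<open>i \<le> m\<close> this] show ?thesis using assms \<open>J \<noteq> 0\<close> by simp
  next
    case 3
    then show ?thesis using J \<open>J \<noteq> 0\<close> \<open>w1 \<noteq> 0\<close> by (simp add: prod_eq_iff)
  qed
qed

section \<open>Approximate multiples of a missing chord\<close>

lemma straight_walk:
  fixes d1 d2 :: int
  shows "\<bar>d1\<bar> + \<bar>d2\<bar> \<le> int c \<Longrightarrow> \<exists>D. walk D c \<and> D 0 = 0 \<and> D c = (d1, d2)"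
proof (induction c arbitrary: d1 d2)
  case 0
  then show ?case by (intro exI[of _ "\<lambda>_. 0"]) (auto simp: walk_def prod_eq_iff)
next
  case (Suc c)
  have "\<exists>e1 e2. \<bar>e1\<bar> + \<bar>e2\<bar> \<le> int c \<and> near (e1, e2) (d1, d2)"
  proof -
    consider "d1 = 0" "d2 = 0" | "d1 \<noteq> 0" | "d2 \<noteq> 0" by blast
    then show ?thesis
    proof cases
      case 1
      then show ?thesis by (intro exI[of _ 0]) (simp add: near_def)
    next
      case 2
      then show ?thesis using Suc.prems
        by (intro exI[of _ "d1 - sgn d1"] exI[of _ d2]) (auto simp: near_def sgn_if)
    next
      case 3
      then show ?thesis using Suc.prems
        by (intro exI[of _ d1] exI[of _ "d2 - sgn d2"]) (auto simp: near_def sgn_if)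
    qed
  qed
  then obtain e1 e2 where e: "\<bar>e1\<bar> + \<bar>e2\<bar> \<le> int c" "near (e1, e2) (d1, d2)" by blast
  from Suc.IH[OF e(1)] obtain D where D: "walk D c" "D 0 = 0" "D c = (e1, e2)" by blast
  have "walk (D(Suc c := (d1, d2))) (Suc c)"
    using D e(2) by (auto simp: walk_def less_Suc_eq)
  moreover have "(D(Suc c := (d1, d2))) 0 = 0" using D(2) by simp
  moreover have "(D(Suc c := (d1, d2))) (Suc c) = (d1, d2)" by simp
  ultimately show ?case by (intro exI[of _ "D(Suc c := (d1, d2))"] conjI)
qed

text \<open>Closing the walk by a short detour gives a walk with period \<open>J w\<close>, which meets its
  translate by \<open>k w\<close> for every \<open>k\<close>. Each such meeting involves the detour, and a short detour
  can only serve boundedly many residues of \<open>k\<close> modulo \<open>J\<close>.\<close>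
lemma no_chord_near_multiple_aux:
  assumes V: "walk V m" and nc: "\<not> chord V m (w1, w2)" and "w1 \<noteq> 0" and "i < j" "j \<le> m"
    and J: "V j - V i = (J * w1 + d1, J * w2 + d2)" and d: "\<bar>d1\<bar> + \<bar>d2\<bar> \<le> int c"
  shows "\<bar>J\<bar> \<le> (int c + 1) * (int c + 1) + 1"
proof (cases "J = 0")
  case True
  then show ?thesis by simp
next
  case False
  have "\<bar>- d1\<bar> + \<bar>- d2\<bar> \<le> int c" using d by simp
  from straight_walk[OF this] obtain D where D: "walk D c" "D 0 = 0" "D c = (- d1, - d2)" by blast
  define l where "l = j - i"
  \<comment> \<open>The segment from i to j, followed by a detour that cancels the error (d1, d2);
    the total displacement is exactly J w.\<close>
  define b where "b t = (if t \<le> l then V (i + t) else V j + D (t - l))" for t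
  have "near (b t) (b (Suc t))" if "t < l + c" for t
  proof -
    consider "Suc t \<le> l" | "t = l" | "l < t" by linarith
    then show ?thesis
    proof cases
      case 1
      then show ?thesis using V \<open>j \<le> m\<close> by (simp add: b_def walk_def l_def)
    next
      case 2
      have "near (D 0) (D (Suc 0))" using D(1) that 2 by (simp add: walk_def)
      then have "near (D 0 + V j) (D (Suc 0) + V j)" by (rule near_add)
      then show ?thesis using 2 D(2) \<open>i < j\<close> by (simp add: b_def l_def add.commute)
    next
      case 3
      then have "near (D (t - l)) (D (Suc (t - l)))" using D(1) that by (simp add: walk_def)
      then have "near (D (t - l) + V j) (D (Suc (t - l)) + V j)" by (rule near_add)
      then show ?thesis using 3 by (simp add: b_def add.commute Suc_diff_le)
    qed
  qed
  then have b: "walk b (l + c)" by (simp add: walk_def)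
  have bN: "b (l + c) = b 0 + (J * w1, J * w2)"
  proof (cases "c = 0")
    case True
    then show ?thesis using J d \<open>i < j\<close> by (auto simp: b_def l_def prod_eq_iff algebra_simps)
  next
    case False
    then show ?thesis using J D(3) \<open>i < j\<close> by (auto simp: b_def l_def prod_eq_iff algebra_simps)
  qed
  have "\<exists>r s z. r \<le> l + c \<and> s \<le> l + c \<and> J dvd (z - k) \<and> b r - b s = (z * w1, z * w2)" for k
  proof -
    obtain r s e where "r \<le> l + c" "s \<le> l + c" "b r - b s = ((k + e * J) * w1, (k + e * J) * w2)"
      using periodic_walk_chord[OF b bN False \<open>w1 \<noteq> 0\<close>, of k] by blast
    then show ?thesis by (intro exI[of _ r] exI[of _ s] exI[of _ "k + e * J"]) auto
  qed
  then obtain r s z where rs: "\<And>k. r k \<le> l + c" "\<And>k. s k \<le> l + c" "\<And>k. J dvd (z k - k)"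
    "\<And>k. b (r k) - b (s k) = (z k * w1, z k * w2)" by metis
  have noV: "y = 0" if "t \<le> l" "u \<le> l" "b t - b u = (y * w1, y * w2)" for t u y
    using that \<open>i < j\<close> \<open>j \<le> m\<close>
    by (intro no_chord_multiple[OF V nc \<open>w1 \<noteq> 0\<close>, of "i + u" "i + t"]) (auto simp: b_def l_def)
  \<comment> \<open>One representative of each nonzero residue modulo J. As z k is congruent to k,
    it is nonzero on \<open>K\<close> and injective there.\<close>
  define K where "K = {1..<\<bar>J\<bar>}"
  have zk: "k = k'" if "k \<in> K" "k' \<in> K" "z k = z k'" for k k'
  proof -
    have "J dvd (z k' - k') - (z k - k)" by (rule dvd_diff[OF rs(3) rs(3)])
    then have "J dvd k - k'" using that(3) by simp
    moreover have "\<bar>k - k'\<bar> < \<bar>J\<bar>" using that by (auto simp: K_def)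
    ultimately show ?thesis using dvd_imp_le_int[of "k - k'" J] by linarith
  qed
  have z0: "z k \<noteq> 0" if "k \<in> K" for k
  proof
    assume "z k = 0"
    then have "J dvd k" using rs(3)[of k] by simp
    then show False using that dvd_imp_le_int[of k J] by (auto simp: K_def)
  qed
  \<comment> \<open>\<open>F\<close> records only indices on the detour; these exceed l, so 0 can
    mark an index on the original segment. By \<open>noV\<close> every meeting uses the detour. If
    \<open>F\<close> agrees for k and k', subtracting the two meetings leaves (z k - z k') w as zero
    or as a difference within the segment, so z k = z k'.\<close>
  define F where "F k = (if l < r k then r k else 0, if l < s k then s k else 0)" for k
  have F0: "l < r k \<or> l < s k" if "k \<in> K" for k
    using noV[of "r k" "s k" "z k"] rs(4) z0[OF that] by (meson not_less)
  have "inj_on F K"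
  proof (rule inj_onI)
    fix k k' assume k: "k \<in> K" "k' \<in> K" and eq: "F k = F k'"
    have zw: "(z k - z k') * w1 = fst (b (r k) - b (s k) - (b (r k') - b (s k')))"
      "(z k - z k') * w2 = snd (b (r k) - b (s k) - (b (r k') - b (s k')))"
      unfolding rs(4) by (simp_all add: algebra_simps)
    have req: "r k = r k'" if "l < r k \<or> l < r k'" using eq that by (auto simp: F_def split: if_splits)
    have seq: "s k = s k'" if "l < s k \<or> l < s k'" using eq that by (auto simp: F_def split: if_splits)
    consider "r k = r k'" "s k = s k'" | "r k = r k'" "s k \<le> l" "s k' \<le> l"
      | "s k = s k'" "r k \<le> l" "r k' \<le> l"
      using req seq F0[OF k(1)] by (meson not_less)
    then have "z k - z k' = 0"
    proof cases
      case 1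
      then show ?thesis using zw(1) \<open>w1 \<noteq> 0\<close> by simp
    next
      case 2
      then show ?thesis using zw by (intro noV[of "s k'" "s k"]) (auto simp: prod_eq_iff)
    next
      case 3
      then show ?thesis using zw by (intro noV[of "r k" "r k'"]) (auto simp: prod_eq_iff)
    qed
    then show "k = k'" using zk k by simp
  qed
  moreover have "F k \<in> insert 0 {l<..l + c} \<times> insert 0 {l<..l + c}" for k
    using rs(1)[of k] rs(2)[of k] by (cases "l < r k"; cases "l < s k") (simp_all add: F_def)
  then have "F ` K \<subseteq> insert 0 {l<..l + c} \<times> insert 0 {l<..l + c}" by blast
  ultimately have "card K \<le> card (insert 0 {l<..l + c} \<times> insert 0 {l<..l + c})"
    by (intro card_inj_on_le) auto
  also have "\<dots> = (c + 1) * (c + 1)" by (subst card_cartesian_product) simp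
  finally have "nat (\<bar>J\<bar> - 1) \<le> (c + 1) * (c + 1)" by (simp add: K_def)
  then have "\<bar>J\<bar> - 1 \<le> int ((c + 1) * (c + 1))" by linarith
  then show ?thesis by (simp add: algebra_simps)
qed

lemma no_chord_near_multiple:
  assumes V: "walk V m" and nc: "\<not> chord V m (w1, w2)" and "w1 \<noteq> 0" and "i \<le> m" "j \<le> m"
    and J: "V j - V i = (J * w1 + d1, J * w2 + d2)" and d: "\<bar>d1\<bar> + \<bar>d2\<bar> \<le> int c"
  shows "\<bar>J\<bar> \<le> (int c + 1) * (int c + 1) + 1"
proof -
  consider "i < j" | "j < i" | "i = j" by linarith
  then show ?thesis
  proof cases
    case 1
    then show ?thesis using no_chord_near_multiple_aux assms by blast
  next
    case 2
    have "V i - V j = ((- J) * w1 + (- d1), (- J) * w2 + (- d2))"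
      using J by (simp add: prod_eq_iff algebra_simps)
    from no_chord_near_multiple_aux[OF V nc \<open>w1 \<noteq> 0\<close> 2 \<open>i \<le> m\<close> this, of c]
    show ?thesis using d by simp
  next
    case 3
    then have "J * w1 = - d1" using J by (simp add: prod_eq_iff)
    then have "\<bar>J\<bar> * \<bar>w1\<bar> \<le> int c" using d by (simp flip: abs_mult)
    moreover have "\<bar>J\<bar> * 1 \<le> \<bar>J\<bar> * \<bar>w1\<bar>" using \<open>w1 \<noteq> 0\<close> by (intro mult_left_mono) auto
    ultimately have "\<bar>J\<bar> \<le> int c" by simp
    moreover have "0 \<le> int c * int c" by simp
    ultimately show ?thesis unfolding distrib_left distrib_right by linarith
  qed
qed

section \<open>Transverse coordinates and counting modulo w\<close>

definition transverse :: "int \<times> int \<Rightarrow> int \<times> int \<Rightarrow> int" where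
  "transverse w u = fst w * snd u - snd w * fst u"

lemma transverse_diff: "transverse w (u - v) = transverse w u - transverse w v"
  by (simp add: transverse_def algebra_simps)

text \<open>\<open>transverse w\<close> is the determinant with w and vanishes on its multiples.
  Points with nearly equal transverse coordinates thus differ by some J w up to a bounded error, and
  \<open>no_chord_near_multiple\<close> bounds J. The bound is uniform in the walk.\<close>

lemma no_chord_transverse_bounded:
  assumes "w1 \<noteq> 0"
  shows "\<exists>C. \<forall>V m i j. walk V m \<longrightarrow> \<not> chord V m (w1, w2) \<longrightarrow> i \<le> m \<longrightarrow> j \<le> m \<longrightarrow>
    \<bar>transverse (w1, w2) (V j - V i)\<bar> \<le> c \<longrightarrow> \<bar>fst (V j - V i)\<bar> + \<bar>snd (V j - V i)\<bar> \<le> C"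
proof -
  define c' where "c' = nat (\<bar>w1\<bar> + \<bar>c\<bar> + \<bar>w1\<bar> * \<bar>w2\<bar>)"
  define B where "B = (int c' + 1) * (int c' + 1) + 1"
  have "\<bar>s\<bar> + \<bar>t\<bar> \<le> B * \<bar>w1\<bar> + B * \<bar>w2\<bar> + int c'"
    if h: "walk V m" "\<not> chord V m (w1, w2)" "i \<le> m" "j \<le> m"
      and c: "\<bar>w1 * t - w2 * s\<bar> \<le> c" and st: "V j - V i = (s, t)" for V m i j s t
  proof -
    \<comment> \<open>Division of the first coordinate by w1 makes d1 small; d2 is then controlled
      by the transverse coordinate.\<close>
    define J d1 d2 where "J = s div w1" and "d1 = s mod w1" and "d2 = t - J * w2"
    have s: "s = J * w1 + d1" and t: "t = J * w2 + d2" by (simp_all add: J_def d1_def d2_def)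
    have d1: "\<bar>d1\<bar> \<le> \<bar>w1\<bar>" unfolding d1_def using abs_mod_less[OF \<open>w1 \<noteq> 0\<close>, of s] by simp
    have "w1 * d2 = (w1 * t - w2 * s) + w2 * d1" by (simp add: s t algebra_simps)
    then have "\<bar>w1 * d2\<bar> \<le> \<bar>c\<bar> + \<bar>w2 * d1\<bar>" using c by linarith
    also have "\<dots> \<le> \<bar>c\<bar> + \<bar>w1\<bar> * \<bar>w2\<bar>" using mult_right_mono[OF d1, of "\<bar>w2\<bar>"] by (simp add: abs_mult mult.commute)
    finally have "\<bar>w1\<bar> * \<bar>d2\<bar> \<le> \<bar>c\<bar> + \<bar>w1\<bar> * \<bar>w2\<bar>" by (simp add: abs_mult)
    moreover have "1 * \<bar>d2\<bar> \<le> \<bar>w1\<bar> * \<bar>d2\<bar>" using \<open>w1 \<noteq> 0\<close> by (intro mult_right_mono) auto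
    ultimately have d: "\<bar>d1\<bar> + \<bar>d2\<bar> \<le> int c'" using d1 by (simp add: c'_def)
    have "\<bar>J\<bar> \<le> B" unfolding B_def
      by (rule no_chord_near_multiple[OF h(1,2) \<open>w1 \<noteq> 0\<close> h(3,4) _ d]) (simp add: st s t)
    then have "\<bar>J * w1\<bar> \<le> B * \<bar>w1\<bar>" "\<bar>J * w2\<bar> \<le> B * \<bar>w2\<bar>"
      by (simp_all add: abs_mult mult_right_mono)
    then show ?thesis using d unfolding s t by linarith
  qed
  then show ?thesis
    by (intro exI[of _ "B * \<bar>w1\<bar> + B * \<bar>w2\<bar> + int c'"]) (simp add: transverse_def, metis prod.collapse fst_diff snd_diff)
qed

text \<open>Reducing a point modulo \<open>w\<close> turns it into an integer \<open>f\<close> that determines its class and differs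
  from its transverse coordinate by a bounded amount.\<close>
lemma no_chord_length:
  assumes V: "walk V m" and inj: "inj_on V {..m}" and nc: "\<not> chord V m (w1, w2)" and w1: "w1 \<noteq> 0"
  shows "\<exists>i\<le>m. \<exists>j\<le>m. int m \<le> transverse (w1, w2) (V j - V i) + 2 * ((\<bar>w2\<bar> + 1) * \<bar>w1\<bar>)"
proof -
  define \<psi> where "\<psi> i = transverse (w1, w2) (V i)" for i
  define E where "E = (\<bar>w2\<bar> + 1) * \<bar>w1\<bar>"
  \<comment> \<open>Subtracting a multiple of w leaves a remainder r modulo w1 in the first
    coordinate and some y in the second; \<open>f\<close> packs both into w1 y + r.\<close>
  define f where "f i = w1 * (snd (V i) - w2 * (fst (V i) div w1)) + fst (V i) mod w1" for i
  have f: "f i = \<psi> i + (w2 + 1) * (fst (V i) mod w1)" for i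
  proof -
    define a r where "a = fst (V i) div w1" and "r = fst (V i) mod w1"
    have "fst (V i) = w1 * a + r" by (simp add: a_def r_def)
    then show ?thesis
      unfolding f_def \<psi>_def transverse_def fst_conv snd_conv a_def[symmetric] r_def[symmetric]
      by (simp add: algebra_simps)
  qed
  have f_near: "\<bar>f i - \<psi> i\<bar> \<le> E" for i
  proof -
    have "\<bar>fst (V i) mod w1\<bar> \<le> \<bar>w1\<bar>" using abs_mod_less[OF w1] by (simp add: less_imp_le)
    moreover have "\<bar>w2 + 1\<bar> \<le> \<bar>w2\<bar> + 1" by simp
    ultimately show ?thesis by (simp add: f E_def abs_mult mult_mono)
  qed
  have "inj_on f {..m}"
  proof (rule inj_onI)
    fix i j assume ij: "i \<in> {..m}" "j \<in> {..m}" and eq: "f i = f j"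
    have "f i mod w1 = fst (V i) mod w1" for i by (simp add: f_def)
    then have r: "fst (V i) mod w1 = fst (V j) mod w1" using eq by metis
    then have t: "snd (V i) - w2 * (fst (V i) div w1) = snd (V j) - w2 * (fst (V j) div w1)"
      using eq w1 by (simp add: f_def)
    define J where "J = fst (V j) div w1 - fst (V i) div w1"
    have "fst (V j) - fst (V i) = (w1 * (fst (V j) div w1) + fst (V j) mod w1)
      - (w1 * (fst (V i) div w1) + fst (V i) mod w1)" by simp
    also have "\<dots> = J * w1" unfolding J_def r by (simp add: algebra_simps)
    finally have "V j - V i = (J * w1, J * w2)" using t by (simp add: prod_eq_iff J_def algebra_simps)
    moreover from this have "J = 0" using ij by (intro no_chord_multiple[OF V nc w1]) auto
    ultimately have "V j - V i = 0" by (simp add: zero_prod_def)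
    then show "i = j" using inj ij by (auto dest: inj_onD)
  qed
  obtain i j where ij: "i \<le> m" "j \<le> m" "\<forall>t\<le>m. \<psi> i \<le> \<psi> t" "\<forall>t\<le>m. \<psi> t \<le> \<psi> j"
    using ex_minimal_index[of m \<psi>] ex_maximal_index[of m \<psi>] by blast
  \<comment> \<open>Pigeonhole: m + 1 distinct values lie in the transverse range enlarged by E on
    either side.\<close>
  have "f ` {..m} \<subseteq> {\<psi> i - E .. \<psi> j + E}"
  proof (rule image_subsetI)
    fix t assume "t \<in> {..m}"
    then have "\<psi> i \<le> \<psi> t" "\<psi> t \<le> \<psi> j" using ij by auto
    then show "f t \<in> {\<psi> i - E .. \<psi> j + E}" using f_near[of t] by (simp add: abs_le_iff)
  qed
  then have "card {..m} \<le> card {\<psi> i - E .. \<psi> j + E}"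
    using \<open>inj_on f {..m}\<close> by (intro card_inj_on_le) auto
  then have "int m \<le> \<psi> j - \<psi> i + 2 * E" by simp
  then show ?thesis using ij(1,2) unfolding E_def \<psi>_def transverse_diff[symmetric] by blast
qed

subsection \<open>Coarse monotonicity\<close>

lemma coarse_intermediate_value:
  fixes g :: "nat \<Rightarrow> int"
  assumes "\<And>i. i < L \<Longrightarrow> \<bar>g (Suc i) - g i\<bar> \<le> K" "0 \<le> K" "g 0 \<le> y" "y \<le> g L"
  shows "\<exists>i\<le>L. \<bar>g i - y\<bar> \<le> K"
proof -
  define i where "i = (LEAST i. y \<le> g i)"
  have i: "y \<le> g i" "i \<le> L" unfolding i_def using assms(4) by (rule LeastI, rule Least_le)
  show ?thesis
  proof (cases i)
    case 0
    then show ?thesis using i assms(2,3) by (intro exI[of _ 0]) auto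
  next
    case (Suc k)
    then have "\<not> y \<le> g k" unfolding i_def using not_less_Least[of k "\<lambda>i. y \<le> g i"] by auto
    moreover have "\<bar>g (Suc k) - g k\<bar> \<le> K" using Suc i(2) by (intro assms(1)) auto
    ultimately show ?thesis using Suc i by (intro exI[of _ i]) auto
  qed
qed

text \<open>Suppose y is far above e L, and let T be the first time when d is close to x. There e is
  close to y, so e passed e L at some j < T, where d is close to d L by \<open>H2\<close>. If x <= d
  j, then d was close to x no later than j, against the choice of T. Otherwise x lies between d j
  and d L, and \<open>H3\<close> puts y close to e L.\<close>

lemma coarse_monotone_up:
  fixes d e :: "nat \<Rightarrow> int"
  assumes K: "0 \<le> K" and C: "0 \<le> C0" "0 \<le> C2"
    and d: "\<And>i. i < L \<Longrightarrow> \<bar>d (Suc i) - d i\<bar> \<le> K" and e: "\<And>i. i < L \<Longrightarrow> \<bar>e (Suc i) - e i\<bar> \<le> K"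
    and x: "d 0 \<le> x" "x \<le> d L" and "e 0 \<le> e L"
    and H1: "\<And>i. i \<le> L \<Longrightarrow> \<bar>d i - x\<bar> \<le> K \<Longrightarrow> \<bar>e i - y\<bar> \<le> C0"
    and H2: "\<And>i. i \<le> L \<Longrightarrow> \<bar>e i - e L\<bar> \<le> K \<Longrightarrow> \<bar>d i - d L\<bar> \<le> C1"
    and H3: "\<bar>x - d L\<bar> \<le> C1 \<Longrightarrow> \<bar>y - e L\<bar> \<le> C2"
  shows "y \<le> e L + (C0 + C2 + K)"
proof (rule ccontr)
  assume neg: "\<not> ?thesis"
  define T where "T = (LEAST i. \<bar>d i - x\<bar> \<le> K)"
  obtain i where i: "i \<le> L" "\<bar>d i - x\<bar> \<le> K"
    using coarse_intermediate_value[OF d K x] by blast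
  have T: "\<bar>d T - x\<bar> \<le> K" "T \<le> i" unfolding T_def using i(2) by (rule LeastI, rule Least_le)
  then have eT: "e T > e L + K" using H1[of T] i(1) neg C by linarith
  have "\<exists>j\<le>T. \<bar>e j - e L\<bar> \<le> K"
    using T(2) i(1) eT K \<open>e 0 \<le> e L\<close> by (intro coarse_intermediate_value e) auto
  then obtain j where j: "j \<le> T" "\<bar>e j - e L\<bar> \<le> K" by blast
  have "j \<noteq> T" using j(2) eT by auto
  then have "j < T" using j(1) by simp
  have dj: "\<bar>d j - d L\<bar> \<le> C1" using H2[of j] j T(2) i(1) by simp
  show False
  proof (cases "x \<le> d j")
    case True
    have "\<exists>k\<le>j. \<bar>d k - x\<bar> \<le> K"
      using \<open>j < T\<close> T(2) i(1) True K x by (intro coarse_intermediate_value d) auto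
    then show False using \<open>j < T\<close> not_less_Least[of _ "\<lambda>i. \<bar>d i - x\<bar> \<le> K"]
      unfolding T_def by (metis order.strict_trans1)
  next
    case False
    then have "\<bar>x - d L\<bar> \<le> C1" using dj x(2) by linarith
    then show False using H3 neg C K by linarith
  qed
qed

text \<open>The previous lemma is applied to the stretch between P and Q. The index S need not lie
  on it: only the values d S and e S enter.\<close>

lemma coarse_monotone:
  fixes d e :: "nat \<Rightarrow> int"
  assumes K: "0 \<le> K" and C: "0 \<le> C0" "0 \<le> C2"
    and d: "\<And>i. i < m \<Longrightarrow> \<bar>d (Suc i) - d i\<bar> \<le> K" and e: "\<And>i. i < m \<Longrightarrow> \<bar>e (Suc i) - e i\<bar> \<le> K"
    and de: "\<And>i j. i \<le> m \<Longrightarrow> j \<le> m \<Longrightarrow> \<bar>d i - d j\<bar> \<le> K \<Longrightarrow> \<bar>e i - e j\<bar> \<le> C0"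
    and ed: "\<And>i j. i \<le> m \<Longrightarrow> j \<le> m \<Longrightarrow> \<bar>e i - e j\<bar> \<le> K \<Longrightarrow> \<bar>d i - d j\<bar> \<le> C1"
    and de': "\<And>i j. i \<le> m \<Longrightarrow> j \<le> m \<Longrightarrow> \<bar>d i - d j\<bar> \<le> C1 \<Longrightarrow> \<bar>e i - e j\<bar> \<le> C2"
    and m: "P \<le> m" "Q \<le> m" "S \<le> m" and S: "d P \<le> d S" "d S \<le> d Q"
  shows "e S \<le> max (e P) (e Q) + (C0 + C2 + K)"
proof -
  define L where "L = (if P \<le> Q then Q - P else P - Q)"
  define g where "g t = (if P \<le> Q then P + t else P - t)" for t
  have g: "g 0 = P" "g L = Q" by (simp_all add: g_def L_def)
  have gm: "g t \<le> m" if "t \<le> L" for t using that m by (auto simp: g_def L_def split: if_splits)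
  have step: "\<bar>f (g (Suc t)) - f (g t)\<bar> \<le> K"
    if f: "\<And>i. i < m \<Longrightarrow> \<bar>f (Suc i) - f i\<bar> \<le> K" and t: "t < L" for f :: "nat \<Rightarrow> int" and t
  proof (cases "P \<le> Q")
    case True
    then show ?thesis using f[of "P + t"] t m by (simp add: g_def L_def)
  next
    case False
    then have "Suc (P - Suc t) = P - t" using t by (simp add: L_def)
    then show ?thesis using False f[of "P - Suc t"] t m by (simp add: g_def L_def abs_minus_commute)
  qed
  show ?thesis
  proof (cases "e P \<le> e Q")
    case True
    have "e S \<le> e (g L) + (C0 + C2 + K)"
      by (rule coarse_monotone_up[where d = "\<lambda>t. d (g t)" and e = "\<lambda>t. e (g t)" and x = "d S" and ?C1.0 = C1])
        (use K C d e de ed de' m S True g gm in \<open>auto intro: step\<close>)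
    then show ?thesis using g by simp
  next
    case False
    \<comment> \<open>If e is larger at P than at Q, reversing time and negating d restores the
      situation of \<open>coarse_monotone_up\<close>, with P as the end.\<close>
    have r: "L - t = Suc (L - Suc t)" "L - Suc t < L" if "t < L" for t using that by auto
    have "e S \<le> e (g (L - L)) + (C0 + C2 + K)"
    proof (rule coarse_monotone_up[where d = "\<lambda>t. - d (g (L - t))" and e = "\<lambda>t. e (g (L - t))"
          and x = "- d S" and ?C1.0 = C1])
      fix t assume t: "t < L"
      show "\<bar>- d (g (L - Suc t)) - - d (g (L - t))\<bar> \<le> K"
        using step[where f = d, OF d r(2)[OF t]] by (simp add: r(1)[OF t, symmetric])
      show "\<bar>e (g (L - Suc t)) - e (g (L - t))\<bar> \<le> K"
        using step[where f = e, OF e r(2)[OF t]] by (simp add: r(1)[OF t, symmetric] abs_minus_commute)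
    next
      fix t assume t: "t \<le> L"
      show "\<bar>e (g (L - t)) - e S\<bar> \<le> C0" if "\<bar>- d (g (L - t)) - - d S\<bar> \<le> K"
        using that m gm by (intro de) auto
      show "\<bar>- d (g (L - t)) - - d (g (L - L))\<bar> \<le> C1" if "\<bar>e (g (L - t)) - e (g (L - L))\<bar> \<le> K"
        using ed[of "g (L - t)" "g (L - L)"] that m gm by (simp add: abs_minus_commute)
    next
      show "\<bar>e S - e (g (L - L))\<bar> \<le> C2" if "\<bar>- d S - - d (g (L - L))\<bar> \<le> C1"
        using that m g by (intro de') auto
    qed (use K C S False g in auto)
    then show ?thesis using g by simp
  qed
qed

lemma transverse_le: "\<bar>transverse w u\<bar> \<le> (\<bar>fst w\<bar> + \<bar>snd w\<bar>) * (\<bar>fst u\<bar> + \<bar>snd u\<bar>)"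
proof -
  have "\<bar>transverse w u\<bar> \<le> \<bar>fst w * snd u\<bar> + \<bar>snd w * fst u\<bar>"
    unfolding transverse_def by linarith
  also have "\<dots> \<le> (\<bar>fst w\<bar> + \<bar>snd w\<bar>) * (\<bar>fst u\<bar> + \<bar>snd u\<bar>)"
    by (simp add: abs_mult distrib_left distrib_right)
  finally show ?thesis .
qed

text \<open>Let P and Q be extremal for the coordinate across w. Coarse monotonicity, applied to the
  coordinate across w' and to its negative, shows that this coordinate nearly attains its extremes
  at P and Q as well. So one pair of indices serves both instances of
  \<open>no_chord_length\<close>.\<close>

lemma no_two_chords_length:
  fixes w w' :: "int \<times> int"
  assumes w: "fst w \<noteq> 0" and w': "fst w' \<noteq> 0"
  shows "\<exists>C. \<forall>V m. walk V m \<longrightarrow> inj_on V {..m} \<longrightarrow> \<not> chord V m w \<longrightarrow> \<not> chord V m w' \<longrightarrow>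
    (\<exists>i\<le>m. \<exists>j\<le>m. 2 * int m \<le> \<bar>transverse w (V j - V i)\<bar> + \<bar>transverse w' (V j - V i)\<bar> + C)"
proof -
  \<comment> \<open>A missing chord u bounds the displacement between points with nearly equal
    coordinate across u, hence also the change of any other transverse coordinate.\<close>
  have bounded: "\<exists>C. 0 \<le> C \<and> (\<forall>V m i j. walk V m \<longrightarrow> \<not> chord V m u \<longrightarrow> i \<le> m \<longrightarrow> j \<le> m \<longrightarrow>
      \<bar>transverse u (V j) - transverse u (V i)\<bar> \<le> c \<longrightarrow> \<bar>transverse v (V j) - transverse v (V i)\<bar> \<le> C)"
    if u: "fst u \<noteq> 0" for u v :: "int \<times> int" and c
  proof -
    obtain B where B: "\<And>V m i j. walk V m \<Longrightarrow> \<not> chord V m u \<Longrightarrow> i \<le> m \<Longrightarrow> j \<le> m \<Longrightarrow>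
      \<bar>transverse u (V j - V i)\<bar> \<le> c \<Longrightarrow> \<bar>fst (V j - V i)\<bar> + \<bar>snd (V j - V i)\<bar> \<le> B"
      using no_chord_transverse_bounded[OF u, of "snd u" c] unfolding prod.collapse by blast
    show ?thesis
    proof (intro exI[of _ "(\<bar>fst v\<bar> + \<bar>snd v\<bar>) * \<bar>B\<bar>"] conjI allI impI)
      fix V m i j
      assume "walk V m" "\<not> chord V m u" "i \<le> m" "j \<le> m" "\<bar>transverse u (V j) - transverse u (V i)\<bar> \<le> c"
      then have "\<bar>fst (V j - V i)\<bar> + \<bar>snd (V j - V i)\<bar> \<le> \<bar>B\<bar>"
        using B[of V m i j] unfolding transverse_diff by linarith
      then have "(\<bar>fst v\<bar> + \<bar>snd v\<bar>) * (\<bar>fst (V j - V i)\<bar> + \<bar>snd (V j - V i)\<bar>) \<le> (\<bar>fst v\<bar> + \<bar>snd v\<bar>) * \<bar>B\<bar>"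
        by (intro mult_left_mono) auto
      then show "\<bar>transverse v (V j) - transverse v (V i)\<bar> \<le> (\<bar>fst v\<bar> + \<bar>snd v\<bar>) * \<bar>B\<bar>"
        using transverse_le[of v "V j - V i"] unfolding transverse_diff by linarith
    qed simp
  qed
  define K where "K = \<bar>fst w\<bar> + \<bar>snd w\<bar> + \<bar>fst w'\<bar> + \<bar>snd w'\<bar>"
  have "0 \<le> K" by (simp add: K_def)
  obtain C0 where C0: "0 \<le> C0" "\<And>V m i j. walk V m \<Longrightarrow> \<not> chord V m w \<Longrightarrow> i \<le> m \<Longrightarrow> j \<le> m \<Longrightarrow>
      \<bar>transverse w (V j) - transverse w (V i)\<bar> \<le> K \<Longrightarrow> \<bar>transverse w' (V j) - transverse w' (V i)\<bar> \<le> C0"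
    using bounded[OF w, of K w'] by metis
  obtain C1 where C1: "\<And>V m i j. walk V m \<Longrightarrow> \<not> chord V m w' \<Longrightarrow> i \<le> m \<Longrightarrow> j \<le> m \<Longrightarrow>
      \<bar>transverse w' (V j) - transverse w' (V i)\<bar> \<le> K \<Longrightarrow> \<bar>transverse w (V j) - transverse w (V i)\<bar> \<le> C1"
    using bounded[OF w', of K w] by metis
  obtain C2 where C2: "0 \<le> C2" "\<And>V m i j. walk V m \<Longrightarrow> \<not> chord V m w \<Longrightarrow> i \<le> m \<Longrightarrow> j \<le> m \<Longrightarrow>
      \<bar>transverse w (V j) - transverse w (V i)\<bar> \<le> C1 \<Longrightarrow> \<bar>transverse w' (V j) - transverse w' (V i)\<bar> \<le> C2"
    using bounded[OF w, of C1 w'] by metis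
  define E where "E = (\<lambda>w :: int \<times> int. 2 * ((\<bar>snd w\<bar> + 1) * \<bar>fst w\<bar>))"
  have "\<exists>i\<le>m. \<exists>j\<le>m. 2 * int m \<le> \<bar>transverse w (V j - V i)\<bar> + \<bar>transverse w' (V j - V i)\<bar>
      + (E w + E w' + 2 * (C0 + C2 + K))"
    if V: "walk V m" and inj: "inj_on V {..m}" and nc: "\<not> chord V m w" "\<not> chord V m w'" for V m
  proof -
    define d e where "d t = transverse w (V t)" and "e t = transverse w' (V t)" for t
    obtain P Q where PQ: "P \<le> m" "Q \<le> m" "\<forall>t\<le>m. d P \<le> d t" "\<forall>t\<le>m. d t \<le> d Q"
      using ex_minimal_index[of m d] ex_maximal_index[of m d] by blast
    have step: "\<bar>fst (V (Suc i) - V i)\<bar> + \<bar>snd (V (Suc i) - V i)\<bar> \<le> 1" if "i < m" for i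
      using V that by (auto simp: walk_def near_def)
    have step': "\<bar>transverse u (V (Suc i)) - transverse u (V i)\<bar> \<le> \<bar>fst u\<bar> + \<bar>snd u\<bar>" if "i < m" for i u
      using transverse_le[of u "V (Suc i) - V i"]
        mult_left_mono[OF step[OF that], of "\<bar>fst u\<bar> + \<bar>snd u\<bar>"] unfolding transverse_diff by simp
    have d: "\<bar>d (Suc i) - d i\<bar> \<le> K" and e: "\<bar>e (Suc i) - e i\<bar> \<le> K" if "i < m" for i
      using step'[OF that, of w] step'[OF that, of w'] unfolding d_def e_def K_def by linarith+
    have de: "\<bar>e i - e j\<bar> \<le> C0" if "i \<le> m" "j \<le> m" "\<bar>d i - d j\<bar> \<le> K" for i j
      using C0(2)[OF V nc(1)] that by (simp add: d_def e_def)
    have ed: "\<bar>d i - d j\<bar> \<le> C1" if "i \<le> m" "j \<le> m" "\<bar>e i - e j\<bar> \<le> K" for i j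
      using C1[OF V nc(2)] that by (simp add: d_def e_def)
    have de': "\<bar>e i - e j\<bar> \<le> C2" if "i \<le> m" "j \<le> m" "\<bar>d i - d j\<bar> \<le> C1" for i j
      using C2(2)[OF V nc(1)] that by (simp add: d_def e_def)
    have upper: "e t \<le> max (e P) (e Q) + (C0 + C2 + K)" if "t \<le> m" for t
      by (rule coarse_monotone[where d = d and e = e and m = m and P = P and Q = Q,
          OF \<open>0 \<le> K\<close> C0(1) C2(1) d e de ed de' PQ(1,2) that])
        (use PQ that in auto)
    have "- e t \<le> max (- e P) (- e Q) + (C0 + C2 + K)" if "t \<le> m" for t
    proof (rule coarse_monotone[where d = d and e = "\<lambda>t. - e t" and m = m and ?C1.0 = C1,
          OF \<open>0 \<le> K\<close> C0(1) C2(1) d])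
      show "\<bar>- e (Suc i) - - e i\<bar> \<le> K" if "i < m" for i using e[OF that] by linarith
      show "\<bar>- e i - - e j\<bar> \<le> C0" if "i \<le> m" "j \<le> m" "\<bar>d i - d j\<bar> \<le> K" for i j
        using de[OF that] by linarith
      show "\<bar>d i - d j\<bar> \<le> C1" if "i \<le> m" "j \<le> m" "\<bar>- e i - - e j\<bar> \<le> K" for i j
        using ed[OF that(1,2)] that(3) by linarith
      show "\<bar>- e i - - e j\<bar> \<le> C2" if "i \<le> m" "j \<le> m" "\<bar>d i - d j\<bar> \<le> C1" for i j
        using de'[OF that] by linarith
    qed (use PQ that in auto)
    then have lower: "e t \<ge> min (e P) (e Q) - (C0 + C2 + K)" if "t \<le> m" for t
      using that by fastforce
    obtain i j where ij: "i \<le> m" "j \<le> m" "int m \<le> d j - d i + E w"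
      using no_chord_length[of V m "fst w" "snd w"] V inj nc w
      unfolding prod.collapse transverse_diff d_def E_def by blast
    obtain i' j' where ij': "i' \<le> m" "j' \<le> m" "int m \<le> e j' - e i' + E w'"
      using no_chord_length[of V m "fst w'" "snd w'"] V inj nc w'
      unfolding prod.collapse transverse_diff e_def E_def by blast
    have "int m \<le> d Q - d P + E w" using ij PQ by (metis add_right_mono diff_mono order.trans)
    moreover have "int m \<le> \<bar>e Q - e P\<bar> + 2 * (C0 + C2 + K) + E w'"
      using ij' upper[OF ij'(2)] lower[OF ij'(1)]
      by (cases "e P \<le> e Q") (simp_all add: max_def min_def)
    ultimately have "2 * int m \<le> \<bar>d Q - d P\<bar> + \<bar>e Q - e P\<bar> + (E w + E w' + 2 * (C0 + C2 + K))"
      by linarith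
    then show ?thesis using PQ(1,2) unfolding transverse_diff d_def e_def by blast
  qed
  then show ?thesis by blast
qed

subsection \<open>Leaper walks with two directions\<close>

lemma lattice_coordinates:
  fixes A :: "nat \<Rightarrow> int \<times> int"
  assumes "\<And>i. i < M \<Longrightarrow> A (Suc i) - A i \<in> {(x1, y1), - (x1, y1), (x2, y2), - (x2, y2)}"
  shows "\<exists>V. walk V M \<and> (\<forall>i\<le>M. A i = A 0 + (fst (V i) * x1 + snd (V i) * x2, fst (V i) * y1 + snd (V i) * y2))"
proof -
  define g :: "nat \<Rightarrow> int \<times> int" where "g k = (if A (Suc k) - A k = (x1, y1) then (1, 0)
    else if A (Suc k) - A k = - (x1, y1) then (- 1, 0)
    else if A (Suc k) - A k = (x2, y2) then (0, 1) else (0, - 1))" for k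
  define V where "V i = (\<Sum>k<i. g k)" for i
  have V: "V 0 = 0" "V (Suc i) = V i + g i" for i by (simp_all add: V_def)
  have "near (V i) (V (Suc i))" for i unfolding V by (simp add: near_def g_def)
  then have "walk V M" by (simp add: walk_def)
  moreover have "A i = A 0 + (fst (V i) * x1 + snd (V i) * x2, fst (V i) * y1 + snd (V i) * y2)" if "i \<le> M" for i
    using that
  proof (induction i)
    case 0
    then show ?case by (simp add: V prod_eq_iff)
  next
    case (Suc i)
    have "A (Suc i) - A i = (fst (g i) * x1 + snd (g i) * x2, fst (g i) * y1 + snd (g i) * y2)"
      using assms[of i] Suc.prems by (auto simp: g_def)
    then have "A (Suc i) = A i + (fst (g i) * x1 + snd (g i) * x2, fst (g i) * y1 + snd (g i) * y2)"
      by (simp add: diff_eq_eq add.commute)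
    then show ?case using Suc by (simp add: V prod_eq_iff algebra_simps)
  qed
  ultimately show ?thesis by blast
qed

text \<open>The walk is studied in lattice coordinates. Oddness makes the coordinates of (N, N) and
  (N, -N) integral, and the hypothesis on x2 and y2 makes their first entries nonzero, as the chord
  lemmas require. The three estimates come from \<open>no_chord_length\<close>, used twice, and
  \<open>no_two_chords_length\<close>.\<close>

lemma two_direction_length:
  fixes x1 y1 x2 y2 N :: int
  assumes odd: "odd x1" "odd y1" "odd x2" "odd y2" and ne: "\<bar>x2\<bar> \<noteq> \<bar>y2\<bar>"
    and N: "\<bar>x1 * y2 - x2 * y1\<bar> = 2 * N"
  shows "\<exists>C. \<forall>A M. (\<forall>i<M. A (Suc i) - A i \<in> {(x1, y1), - (x1, y1), (x2, y2), - (x2, y2)}) \<longrightarrow>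
    inj_on A {..M} \<longrightarrow>
    (\<not> chord A M (N, N) \<longrightarrow>
      (\<exists>i\<le>M. \<exists>j\<le>M. 2 * int M \<le> \<bar>fst (A j - A i) - snd (A j - A i)\<bar> + C)) \<and>
    (\<not> chord A M (N, - N) \<longrightarrow>
      (\<exists>i\<le>M. \<exists>j\<le>M. 2 * int M \<le> \<bar>fst (A j - A i) + snd (A j - A i)\<bar> + C)) \<and>
    (\<not> chord A M (N, N) \<longrightarrow> \<not> chord A M (N, - N) \<longrightarrow>
      (\<exists>i\<le>M. \<exists>j\<le>M. 4 * int M \<le> \<bar>fst (A j - A i) - snd (A j - A i)\<bar> + \<bar>fst (A j - A i) + snd (A j - A i)\<bar> + C))"
proof -
  \<comment> \<open>By Cramer's rule, \<open>(a, b)\<close> and \<open>(a', b')\<close> are the lattice coordinates of \<open>(N, N)\<close> and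
    \<open>(N, -N)\<close> up to sign; the transverse coordinates are then \<open>(x - y) / 2\<close> and \<open>(x + y) / 2\<close>.\<close>
  obtain a b a' b' where ab: "x2 - y2 = 2 * a" "- (x1 - y1) = 2 * b" "x2 + y2 = 2 * a'" "- (x1 + y1) = 2 * b'"
    using odd by (metis even_add even_diff even_minus evenE)
  have a: "a \<noteq> 0" "a' \<noteq> 0" using ne ab by auto
  obtain C0 where C0: "\<And>V m. walk V m \<Longrightarrow> inj_on V {..m} \<Longrightarrow> \<not> chord V m (a, b) \<Longrightarrow> \<not> chord V m (a', b') \<Longrightarrow>
    (\<exists>i\<le>m. \<exists>j\<le>m. 2 * int m \<le> \<bar>transverse (a, b) (V j - V i)\<bar> + \<bar>transverse (a', b') (V j - V i)\<bar> + C0)"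
    using no_two_chords_length[of "(a, b)" "(a', b')"] a by auto
  define C where "C = 4 * ((\<bar>b\<bar> + 1) * \<bar>a\<bar>) + 4 * ((\<bar>b'\<bar> + 1) * \<bar>a'\<bar>) + 2 * \<bar>C0\<bar>"
  have nonneg: "0 \<le> (\<bar>b\<bar> + 1) * \<bar>a\<bar>" "0 \<le> (\<bar>b'\<bar> + 1) * \<bar>a'\<bar>" by simp_all
  show ?thesis
  proof (intro exI[of _ C] allI impI)
    fix A :: "nat \<Rightarrow> int \<times> int" and M
    assume steps: "\<forall>i<M. A (Suc i) - A i \<in> {(x1, y1), - (x1, y1), (x2, y2), - (x2, y2)}"
      and inj: "inj_on A {..M}"
    obtain V where V: "walk V M"
      and AV: "\<And>i. i \<le> M \<Longrightarrow> A i = A 0 + (fst (V i) * x1 + snd (V i) * x2, fst (V i) * y1 + snd (V i) * y2)"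
      using lattice_coordinates[of M A x1 y1 x2 y2] steps by blast
    have injV: "inj_on V {..M}"
    proof (rule inj_onI)
      fix i j assume ij: "i \<in> {..M}" "j \<in> {..M}" "V i = V j"
      then have "A i = A j" using AV[of i] AV[of j] by simp
      then show "i = j" using inj ij by (auto dest: inj_onD)
    qed
    have diff: "A j - A i = (s * x1 + t * x2, s * y1 + t * y2)"
      if "i \<le> M" "j \<le> M" "V j - V i = (s, t)" for i j s t
    proof -
      have st: "s = fst (V j) - fst (V i)" "t = snd (V j) - snd (V i)" using that(3) by (auto simp: prod_eq_iff)
      show ?thesis unfolding st
        using AV[OF that(1)] AV[OF that(2)] by (simp add: prod_eq_iff algebra_simps)
    qed
    have tr: "2 * transverse (a, b) (V j - V i) = fst (A j - A i) - snd (A j - A i)"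
      "2 * transverse (a', b') (V j - V i) = fst (A j - A i) + snd (A j - A i)"
      if ij: "i \<le> M" "j \<le> M" for i j
    proof -
      obtain s t where st: "V j - V i = (s, t)" by (metis prod.exhaust)
      have "2 * transverse (a, b) (s, t) = (2 * a) * t - (2 * b) * s"
        "2 * transverse (a', b') (s, t) = (2 * a') * t - (2 * b') * s"
        by (simp_all add: transverse_def)
      then show "2 * transverse (a, b) (V j - V i) = fst (A j - A i) - snd (A j - A i)"
        "2 * transverse (a', b') (V j - V i) = fst (A j - A i) + snd (A j - A i)"
        unfolding diff[OF ij st] st ab[symmetric] by (simp_all add: algebra_simps)
    qed
    have chA: "chord A M u" if "chord V M (s, t)" "u = (s * x1 + t * x2, s * y1 + t * y2)" for u s t
      using that diff unfolding chord_def by blast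
    have D: "x1 * y2 - x2 * y1 = 2 * N \<or> x1 * y2 - x2 * y1 = - 2 * N" using N by linarith
    have w1: "2 * (a * x1 + b * x2) = - (x1 * y2 - x2 * y1)" using ab by algebra
    have w2: "2 * (a * y1 + b * y2) = - (x1 * y2 - x2 * y1)" using ab by algebra
    have w3: "2 * (a' * x1 + b' * x2) = x1 * y2 - x2 * y1" using ab by algebra
    have w4: "2 * (a' * y1 + b' * y2) = - (x1 * y2 - x2 * y1)" using ab by algebra
    have nc: "\<not> chord V M (a, b)" if "\<not> chord A M (N, N)"
    proof
      assume "chord V M (a, b)"
      moreover have "(a * x1 + b * x2, a * y1 + b * y2) = - (N, N) \<or> (a * x1 + b * x2, a * y1 + b * y2) = (N, N)"
        using D w1 w2 by auto
      ultimately show False using chA that chord_uminus by metis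
    qed
    have nc': "\<not> chord V M (a', b')" if "\<not> chord A M (N, - N)"
    proof
      assume "chord V M (a', b')"
      moreover have "(a' * x1 + b' * x2, a' * y1 + b' * y2) = - (N, - N) \<or> (a' * x1 + b' * x2, a' * y1 + b' * y2) = (N, - N)"
        using D w3 w4 by auto
      ultimately show False using chA that chord_uminus by metis
    qed
    show "(\<not> chord A M (N, N) \<longrightarrow>
      (\<exists>i\<le>M. \<exists>j\<le>M. 2 * int M \<le> \<bar>fst (A j - A i) - snd (A j - A i)\<bar> + C)) \<and>
    (\<not> chord A M (N, - N) \<longrightarrow>
      (\<exists>i\<le>M. \<exists>j\<le>M. 2 * int M \<le> \<bar>fst (A j - A i) + snd (A j - A i)\<bar> + C)) \<and>
    (\<not> chord A M (N, N) \<longrightarrow> \<not> chord A M (N, - N) \<longrightarrow>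
      (\<exists>i\<le>M. \<exists>j\<le>M. 4 * int M \<le> \<bar>fst (A j - A i) - snd (A j - A i)\<bar> + \<bar>fst (A j - A i) + snd (A j - A i)\<bar> + C))"
    proof (intro conjI impI)
      assume "\<not> chord A M (N, N)"
      then obtain i j where ij: "i \<le> M" "j \<le> M" "int M \<le> transverse (a, b) (V j - V i) + 2 * ((\<bar>b\<bar> + 1) * \<bar>a\<bar>)"
        using no_chord_length[OF V injV nc a(1)] by blast
      then have "2 * int M \<le> \<bar>fst (A j - A i) - snd (A j - A i)\<bar> + C"
        using tr(1)[OF ij(1,2)] nonneg unfolding C_def by linarith
      then show "\<exists>i\<le>M. \<exists>j\<le>M. 2 * int M \<le> \<bar>fst (A j - A i) - snd (A j - A i)\<bar> + C" using ij by blast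
    next
      assume "\<not> chord A M (N, - N)"
      then obtain i j where ij: "i \<le> M" "j \<le> M" "int M \<le> transverse (a', b') (V j - V i) + 2 * ((\<bar>b'\<bar> + 1) * \<bar>a'\<bar>)"
        using no_chord_length[OF V injV nc' a(2)] by blast
      then have "2 * int M \<le> \<bar>fst (A j - A i) + snd (A j - A i)\<bar> + C"
        using tr(2)[OF ij(1,2)] nonneg unfolding C_def by linarith
      then show "\<exists>i\<le>M. \<exists>j\<le>M. 2 * int M \<le> \<bar>fst (A j - A i) + snd (A j - A i)\<bar> + C" using ij by blast
    next
      assume "\<not> chord A M (N, N)" "\<not> chord A M (N, - N)"
      then obtain i j where ij: "i \<le> M" "j \<le> M"
        "2 * int M \<le> \<bar>transverse (a, b) (V j - V i)\<bar> + \<bar>transverse (a', b') (V j - V i)\<bar> + C0"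
        using C0[OF V injV nc nc'] by blast
      then have "4 * int M \<le> \<bar>fst (A j - A i) - snd (A j - A i)\<bar> + \<bar>fst (A j - A i) + snd (A j - A i)\<bar> + C"
        using tr[OF ij(1,2)] nonneg unfolding C_def by linarith
      then show "\<exists>i\<le>M. \<exists>j\<le>M. 4 * int M \<le> \<bar>fst (A j - A i) - snd (A j - A i)\<bar> + \<bar>fst (A j - A i) + snd (A j - A i)\<bar> + C"
        using ij by blast
    qed
  qed
qed

subsection \<open>Embeddings as sums of two walks\<close>

text \<open>Put s = a + b. Equality of norms makes a - c and c - b orthogonal to s and to each
  other. In the plane, with s nonzero, one of them must vanish, and c = b would give a = e.\<close>

lemma equal_norm_parallelogram:
  fixes a b c e :: "int \<times> int"
  assumes "fst a ^ 2 + snd a ^ 2 = R" "fst b ^ 2 + snd b ^ 2 = R"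
    "fst c ^ 2 + snd c ^ 2 = R" "fst e ^ 2 + snd e ^ 2 = R"
    and sum: "a + b = c + e" and "a + b \<noteq> 0" "a \<noteq> e"
  shows "a = c"
proof -
  obtain a1 a2 b1 b2 c1 c2 where abc: "a = (a1, a2)" "b = (b1, b2)" "c = (c1, c2)"
    by (metis prod.exhaust)
  have "e = a + b - c" using sum by simp
  then have e: "e = (a1 + b1 - c1, a2 + b2 - c2)" by (simp add: abc)
  define u1 u2 v1 v2 s1 s2 where "u1 = a1 - c1" and "u2 = a2 - c2" and "v1 = c1 - b1" and "v2 = c2 - b2"
    and "s1 = a1 + b1" and "s2 = a2 + b2"
  note defs = u1_def u2_def v1_def v2_def s1_def s2_def
  have R: "a1\<^sup>2 + a2\<^sup>2 = R" "b1\<^sup>2 + b2\<^sup>2 = R" "c1\<^sup>2 + c2\<^sup>2 = R" "(a1 + b1 - c1)\<^sup>2 + (a2 + b2 - c2)\<^sup>2 = R"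
    using assms(1-4) by (simp_all add: abc e)
  have us: "u1 * s1 + u2 * s2 = 0"
    using R unfolding defs power2_eq_square by (simp only: algebra_simps)
  have vs: "v1 * s1 + v2 * s2 = 0"
    using R unfolding defs power2_eq_square by (simp only: algebra_simps)
  have uv: "u1 * v1 + u2 * v2 = 0"
    using R unfolding defs power2_eq_square by (simp only: algebra_simps)
  have s: "s1 \<noteq> 0 \<or> s2 \<noteq> 0" using \<open>a + b \<noteq> 0\<close> by (auto simp: abc defs zero_prod_def)
  then have s2: "s1\<^sup>2 + s2\<^sup>2 \<noteq> 0" by (simp add: sum_power2_eq_zero_iff)
  have zero: "x = 0 \<and> y = 0" if "x * s1 + y * s2 = 0" "x * s2 - y * s1 = 0" for x y
  proof -
    have "x * (s1\<^sup>2 + s2\<^sup>2) = (x * s1 + y * s2) * s1 + (x * s2 - y * s1) * s2"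
      "y * (s1\<^sup>2 + s2\<^sup>2) = (x * s1 + y * s2) * s2 - (x * s2 - y * s1) * s1"
      by (simp_all add: algebra_simps power2_eq_square)
    then show ?thesis unfolding that using s2 by auto
  qed
  have "(u1 * s2 - u2 * s1) * (v1 * s2 - v2 * s1)
      = (u1 * v1 + u2 * v2) * (s1\<^sup>2 + s2\<^sup>2) - (u1 * s1 + u2 * s2) * (v1 * s1 + v2 * s2)"
    by (simp add: algebra_simps power2_eq_square)
  then have "(u1 * s2 - u2 * s1) * (v1 * s2 - v2 * s1) = 0" unfolding us uv by simp
  then consider "u1 * s2 - u2 * s1 = 0" | "v1 * s2 - v2 * s1 = 0" by auto
  then show ?thesis
  proof cases
    case 1
    then show ?thesis using zero[OF us] by (simp add: abc defs)
  next
    case 2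
    then have "c1 = b1" "c2 = b2" using zero[OF vs] by (simp_all add: defs)
    then show ?thesis using \<open>a \<noteq> e\<close> by (simp add: abc e)
  qed
qed

definition leaper_moves :: "int \<Rightarrow> int \<Rightarrow> (int \<times> int) set" where
  "leaper_moves p q = {v. {\<bar>fst v\<bar>, \<bar>snd v\<bar>} = {p, q}}"

lemma leaper_moves_uminus: "- v \<in> leaper_moves p q \<longleftrightarrow> v \<in> leaper_moves p q"
  by (simp add: leaper_moves_def)

lemma leaper_moves_norm:
  assumes "v \<in> leaper_moves p q"
  shows "fst v ^ 2 + snd v ^ 2 = p\<^sup>2 + q\<^sup>2"
proof -
  have "\<bar>fst v\<bar> = p \<and> \<bar>snd v\<bar> = q \<or> \<bar>fst v\<bar> = q \<and> \<bar>snd v\<bar> = p"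
    using assms by (auto simp: leaper_moves_def doubleton_eq_iff)
  then show ?thesis by (metis add.commute power2_abs)
qed

lemma leaper_arc_iff:
  "(u, v) \<in> parcs (leaper_graph p q n) \<longleftrightarrow> u \<in> board n \<and> v \<in> board n \<and> v - u \<in> leaper_moves p q"
  by (cases u; cases v) (simp add: leaper_graph_def leaper_moves_def abs_minus_commute)

lemma grid_arc_iff:
  "(u, v) \<in> parcs (grid_graph m) \<longleftrightarrow>
    u \<in> board m \<and> v \<in> board m \<and> v - u \<in> {(1, 0), (- 1, 0), (0, 1), (0, - 1)}"
proof -
  obtain a b c d where uv: "u = (a, b)" "v = (c, d)" by (metis prod.exhaust)
  have "dist (real_of_int a, real_of_int b) (real_of_int c, real_of_int d)
      = sqrt (real_of_int ((c - a)\<^sup>2 + (d - b)\<^sup>2))"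
    by (simp add: dist_Pair_Pair dist_real_def power2_commute)
  then have "dist (real_of_int a, real_of_int b) (real_of_int c, real_of_int d) = 1
      \<longleftrightarrow> (c - a)\<^sup>2 + (d - b)\<^sup>2 = 1"
    by (metis of_int_eq_1_iff real_sqrt_eq_1_iff)
  also have "\<dots> \<longleftrightarrow> (c - a, d - b) \<in> {(1, 0), (- 1, 0), (0, 1), (0, - 1)}"
  proof
    assume eq: "(c - a)\<^sup>2 + (d - b)\<^sup>2 = 1"
    have "\<bar>x\<bar> \<le> 1" if "x\<^sup>2 \<le> 1" for x :: int using that by (simp add: abs_square_le_1)
    then have "\<bar>c - a\<bar> \<le> 1" "\<bar>d - b\<bar> \<le> 1" using eq by (metis le_add_same_cancel1 le_add_same_cancel2 zero_le_power2)+
    then have "c - a \<in> {- 1, 0, 1}" "d - b \<in> {- 1, 0, 1}" by auto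
    then show "(c - a, d - b) \<in> {(1, 0), (- 1, 0), (0, 1), (0, - 1)}" using eq by auto
  qed auto
  finally show ?thesis by (simp add: uv grid_graph_def)
qed

lemma inj_on_pairI:
  assumes "\<And>i j i' j'. i \<in> S \<Longrightarrow> j \<in> T \<Longrightarrow> i' \<in> S \<Longrightarrow> j' \<in> T \<Longrightarrow> g i j = g i' j' \<Longrightarrow> i = i' \<and> j = j'"
  shows "inj_on (\<lambda>(i, j). g i j) (S \<times> T)"
  using assms by (fastforce simp: inj_on_def)

text \<open>The indices run from 0 to M, so the grid has side M + 1 and each walk has M
  steps.\<close>

definition sum_embedding :: "int \<Rightarrow> int \<Rightarrow> nat \<Rightarrow> nat \<Rightarrow> (nat \<Rightarrow> int \<times> int) \<Rightarrow> (nat \<Rightarrow> int \<times> int) \<Rightarrow> bool"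
  where "sum_embedding p q n M A B \<longleftrightarrow>
    (\<forall>i<M. A (Suc i) - A i \<in> leaper_moves p q) \<and> (\<forall>j<M. B (Suc j) - B j \<in> leaper_moves p q) \<and>
    (\<forall>i\<le>M. \<forall>j\<le>M. A i + B j \<in> board n) \<and> inj_on (\<lambda>(i, j). A i + B j) ({..M} \<times> {..M})"

text \<open>Each unit square is sent to a parallelogram, so the horizontal step from (i, j) does not
  depend on j.\<close>

lemma embeds_imp_sum_embedding:
  assumes "embeds_into (grid_graph (Suc M)) (leaper_graph p q n)"
  shows "\<exists>A B. sum_embedding p q n M A B"
proof -
  obtain f where inj: "inj_on f (board (Suc M))" and range: "f ` board (Suc M) \<subseteq> board n"
    and arcs: "\<And>u v. (u, v) \<in> parcs (grid_graph (Suc M)) \<Longrightarrow> (f u, f v) \<in> parcs (leaper_graph p q n)"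
    using assms unfolding embeds_into_grid_leaper_iff by fast
  define F where "F i j = f (1 + int i, 1 + int j)" for i j :: nat
  have pos: "(1 + int i, 1 + int j) \<in> board (Suc M)" if "i \<le> M" "j \<le> M" for i j
    using that by (simp add: board_def)
  have F_eq: "F i j = F i' j' \<longleftrightarrow> i = i' \<and> j = j'" if "i \<le> M" "j \<le> M" "i' \<le> M" "j' \<le> M" for i j i' j'
    unfolding F_def using inj_on_eq_iff[OF inj pos[OF that(1,2)] pos[OF that(3,4)]] by simp
  have hor: "F (Suc i) j - F i j \<in> leaper_moves p q" if "i < M" "j \<le> M" for i j
    unfolding F_def using that pos[of i j] pos[of "Suc i" j]
    by (intro leaper_arc_iff[THEN iffD1, THEN conjunct2, THEN conjunct2, OF arcs]) (simp add: grid_arc_iff)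
  have ver: "F i (Suc j) - F i j \<in> leaper_moves p q" if "i \<le> M" "j < M" for i j
    unfolding F_def using that pos[of i j] pos[of i "Suc j"]
    by (intro leaper_arc_iff[THEN iffD1, THEN conjunct2, THEN conjunct2, OF arcs]) (simp add: grid_arc_iff)
  have square: "F (Suc i) j - F i j = F (Suc i) (Suc j) - F i (Suc j)" if ij: "i < M" "j < M" for i j
  proof (rule equal_norm_parallelogram[where R = "p\<^sup>2 + q\<^sup>2"])
    show "F (Suc i) j - F i j + (F (Suc i) (Suc j) - F (Suc i) j)
        = F (Suc i) (Suc j) - F i (Suc j) + (F i (Suc j) - F i j)" by simp
    \<comment> \<open>Injectivity on the two diagonals of the square excludes the degenerate
      cases.\<close>
    have "F (Suc i) (Suc j) \<noteq> F i j" "F (Suc i) j \<noteq> F i (Suc j)"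
      using ij by (simp_all add: F_eq)
    then show "F (Suc i) j - F i j + (F (Suc i) (Suc j) - F (Suc i) j) \<noteq> 0"
      "F (Suc i) j - F i j \<noteq> F i (Suc j) - F i j" by simp_all
  qed (use ij in \<open>auto intro!: leaper_moves_norm hor ver simp del: fst_diff snd_diff\<close>)
  have col: "F (Suc i) j - F i j = F (Suc i) 0 - F i 0" if "i < M" "j \<le> M" for i j
    using that(2)
  proof (induction j)
    case (Suc j)
    then show ?case using square[of i j] that(1) by simp
  qed simp
  have sum: "F i j = F i 0 + (F 0 j - F 0 0)" if "i \<le> M" "j \<le> M" for i j
    using that(1)
  proof (induction i)
    case (Suc i)
    then have "F (Suc i) j = F i j + (F (Suc i) 0 - F i 0)"
      using col[of i j] that(2) by (simp add: diff_eq_eq add.commute)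
    then show ?case using Suc by simp
  qed simp
  have "sum_embedding p q n M (\<lambda>i. F i 0) (\<lambda>j. F 0 j - F 0 0)"
    unfolding sum_embedding_def
  proof (intro conjI allI impI)
    show "F i 0 + (F 0 j - F 0 0) \<in> board n" if "i \<le> M" "j \<le> M" for i j
    proof -
      have "F i j \<in> board n" unfolding F_def using range pos[OF that] by blast
      then show ?thesis unfolding sum[OF that] .
    qed
    show "inj_on (\<lambda>(i, j). F i 0 + (F 0 j - F 0 0)) ({..M} \<times> {..M})"
    proof (rule inj_on_pairI)
      fix i j i' j' assume h: "i \<in> {..M}" "j \<in> {..M}" "i' \<in> {..M}" "j' \<in> {..M}"
        and eq: "F i 0 + (F 0 j - F 0 0) = F i' 0 + (F 0 j' - F 0 0)"
      have "F i j = F i 0 + (F 0 j - F 0 0)" "F i' j' = F i' 0 + (F 0 j' - F 0 0)"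
        using h by (auto intro!: sum)
      then have "F i j = F i' j'" using eq by argo
      then show "i = i' \<and> j = j'" using F_eq[of i j i' j'] h by blast
    qed
  qed (use hor ver in auto)
  then show ?thesis by blast
qed

lemma sum_embedding_imp_embeds:
  assumes "sum_embedding p q n M A B"
  shows "embeds_into (grid_graph (Suc M)) (leaper_graph p q n)"
proof -
  define f where "f = (\<lambda>(x, y). A (nat (x - 1)) + B (nat (y - 1)))"
  have A: "A (Suc i) - A i \<in> leaper_moves p q" and B: "B (Suc i) - B i \<in> leaper_moves p q" if "i < M" for i
    using assms that by (auto simp: sum_embedding_def)
  have idx: "nat (x - 1) \<le> M" "nat (y - 1) \<le> M" "1 \<le> x" "1 \<le> y" if "(x, y) \<in> board (Suc M)" for x y
    using that by (auto simp: board_def)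
  have fb: "f u \<in> board n" if "u \<in> board (Suc M)" for u
    using that idx[of "fst u" "snd u"] assms by (cases u) (simp add: f_def sum_embedding_def)
  have "inj_on f (board (Suc M))"
  proof (rule inj_onI, clarify)
    fix x y x' y' assume h: "(x, y) \<in> board (Suc M)" "(x', y') \<in> board (Suc M)" "f (x, y) = f (x', y')"
    have "(nat (x - 1), nat (y - 1)) = (nat (x' - 1), nat (y' - 1))"
      by (rule inj_onD[of "\<lambda>(i, j). A i + B j" "{..M} \<times> {..M}"])
        (use h idx[OF h(1)] idx[OF h(2)] assms in \<open>simp_all add: f_def sum_embedding_def\<close>)
    then show "x = x' \<and> y = y'" using idx[OF h(1)] idx[OF h(2)] by auto
  qed
  moreover have "(f u, f v) \<in> parcs (leaper_graph p q n)" if uv: "(u, v) \<in> parcs (grid_graph (Suc M))" for u v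
  proof -
    obtain x y where u: "u = (x, y)" by (metis prod.exhaust)
    have b: "u \<in> board (Suc M)" "v \<in> board (Suc M)" "v - u \<in> {(1, 0), (- 1, 0), (0, 1), (0, - 1)}"
      using uv unfolding grid_arc_iff by auto
    then have v: "v \<in> {(x + 1, y), (x - 1, y), (x, y + 1), (x, y - 1)}"
      by (cases v) (auto simp: u)
    note i = idx[OF b(1)[unfolded u]]
    have "f v - f u \<in> leaper_moves p q"
    proof -
      consider "v = (x + 1, y)" | "v = (x - 1, y)" | "v = (x, y + 1)" | "v = (x, y - 1)" using v by blast
      then show ?thesis
      proof cases
        case 1
        then have "nat (x + 1 - 1) = Suc (nat (x - 1))" "nat (x - 1) < M"
          using b(2) i by (auto simp: board_def)
        then show ?thesis using A[of "nat (x - 1)"] by (simp add: f_def u 1)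
      next
        case 2
        then have e: "nat (x - 1) = Suc (nat (x - 1 - 1))" "nat (x - 1 - 1) < M"
          using b i by (auto simp: board_def u)
        have "f v - f u = - (A (nat (x - 1)) - A (nat (x - 1 - 1)))" by (simp add: f_def u 2)
        also have "\<dots> = - (A (Suc (nat (x - 1 - 1))) - A (nat (x - 1 - 1)))" using e(1) by simp
        finally show ?thesis using A[OF e(2)] leaper_moves_uminus by metis
      next
        case 3
        then have "nat (y + 1 - 1) = Suc (nat (y - 1))" "nat (y - 1) < M"
          using b(2) i by (auto simp: board_def)
        then show ?thesis using B[of "nat (y - 1)"] by (simp add: f_def u 3)
      next
        case 4
        then have e: "nat (y - 1) = Suc (nat (y - 1 - 1))" "nat (y - 1 - 1) < M"
          using b i by (auto simp: board_def u)
        have "f v - f u = - (B (nat (y - 1)) - B (nat (y - 1 - 1)))" by (simp add: f_def u 4)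
        also have "\<dots> = - (B (Suc (nat (y - 1 - 1))) - B (nat (y - 1 - 1)))" using e(1) by simp
        finally show ?thesis using B[OF e(2)] leaper_moves_uminus by metis
      qed
    qed
    then show ?thesis using fb b by (simp add: leaper_arc_iff)
  qed
  ultimately show ?thesis
    unfolding embeds_into_grid_leaper_iff using fb by blast
qed

subsection \<open>The upper bound\<close>

text \<open>Injectivity forbids turning back, so all steps are equal.\<close>

lemma straight_length:
  fixes A :: "nat \<Rightarrow> int \<times> int"
  assumes steps: "\<And>i. i < M \<Longrightarrow> A (Suc i) - A i \<in> {e, - e}" and inj: "inj_on A {..M}"
  shows "\<bar>fst (A M - A 0)\<bar> = int M * \<bar>fst e\<bar>" "\<bar>snd (A M - A 0)\<bar> = int M * \<bar>snd e\<bar>"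
proof -
  define s where "s = A 1 - A 0"
  have same: "A (Suc i) - A i = s" if "i < M" for i
    using that
  proof (induction i)
    case (Suc i)
    have "A (Suc (Suc i)) \<noteq> A i" using inj Suc.prems by (auto dest: inj_onD)
    then have "A (Suc (Suc i)) - A (Suc i) \<noteq> - (A (Suc i) - A i)" by simp
    then show ?case using Suc steps[of "Suc i"] steps[of i] by auto
  qed (simp add: s_def)
  have "fst (A i - A 0) = int i * fst s \<and> snd (A i - A 0) = int i * snd s" if "i \<le> M" for i
    using that
  proof (induction i)
    case (Suc i)
    have "A (Suc i) = A i + s" using same[of i] Suc.prems by (simp add: diff_eq_eq add.commute)
    then show ?case using Suc by (simp add: algebra_simps)
  qed simp
  moreover have "\<bar>fst s\<bar> = \<bar>fst e\<bar> \<and> \<bar>snd s\<bar> = \<bar>snd e\<bar>" if "0 < M"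
  proof -
    have "s = e \<or> s = - e" using steps[of 0] that by (simp add: s_def)
    then show ?thesis by auto
  qed
  ultimately show "\<bar>fst (A M - A 0)\<bar> = int M * \<bar>fst e\<bar>" "\<bar>snd (A M - A 0)\<bar> = int M * \<bar>snd e\<bar>"
    by (cases "M = 0"; simp add: abs_mult del: fst_diff snd_diff)+
qed

lemma sum_embedding_commute: "sum_embedding p q n M A B \<Longrightarrow> sum_embedding p q n M B A"
proof -
  assume h: "sum_embedding p q n M A B"
  have "inj_on (\<lambda>(i, j). B i + A j) ({..M} \<times> {..M})"
  proof (rule inj_on_pairI)
    fix i j i' j' assume m: "i \<in> {..M}" "j \<in> {..M}" "i' \<in> {..M}" "j' \<in> {..M}" and eq: "B i + A j = B i' + A j'"
    have "(j, i) = (j', i')"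
      by (rule inj_onD[of "\<lambda>(i, j). A i + B j" "{..M} \<times> {..M}"])
        (use h m eq in \<open>auto simp: sum_embedding_def add.commute\<close>)
    then show "i = i' \<and> j = j'" by simp
  qed
  then show ?thesis using h by (auto simp: sum_embedding_def add.commute)
qed

lemma sum_embedding_eq_iff:
  assumes "sum_embedding p q n M A B" "i \<le> M" "j \<le> M" "i' \<le> M" "j' \<le> M"
  shows "A i + B j = A i' + B j' \<longleftrightarrow> i = i' \<and> j = j'"
proof -
  have "inj_on (\<lambda>(i, j). A i + B j) ({..M} \<times> {..M})" using assms by (simp add: sum_embedding_def)
  from inj_on_eq_iff[OF this, of "(i, j)" "(i', j')"] show ?thesis using assms by simp
qed

lemma sum_embedding_inj:
  assumes "sum_embedding p q n M A B"
  shows "inj_on A {..M}"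
proof (rule inj_onI)
  fix i j assume ij: "i \<in> {..M}" "j \<in> {..M}" "A i = A j"
  then show "i = j" using sum_embedding_eq_iff[OF assms, of i 0 j 0] by simp
qed

text \<open>The two indices vary independently, so the displacements of the two walks add up within
  the board, whatever their signs.\<close>

lemma sum_embedding_width:
  assumes "sum_embedding p q n M A B" "i \<le> M" "i' \<le> M" "j \<le> M" "j' \<le> M"
  shows "\<bar>fst (A i' - A i)\<bar> + \<bar>fst (B j' - B j)\<bar> \<le> int n" "\<bar>snd (A i' - A i)\<bar> + \<bar>snd (B j' - B j)\<bar> \<le> int n"
proof -
  have b: "1 \<le> fst (A i) + fst (B j)" "fst (A i) + fst (B j) \<le> int n"
     "1 \<le> snd (A i) + snd (B j)" "snd (A i) + snd (B j) \<le> int n" if "i \<le> M" "j \<le> M" for i j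
    using assms(1) that by (auto simp: sum_embedding_def board_def mem_Times_iff)
  show "\<bar>fst (A i' - A i)\<bar> + \<bar>fst (B j' - B j)\<bar> \<le> int n"
    using b(1,2)[of i j] b(1,2)[of i j'] b(1,2)[of i' j] b(1,2)[of i' j'] assms(2-5) by (simp add: abs_if)
  show "\<bar>snd (A i' - A i)\<bar> + \<bar>snd (B j' - B j)\<bar> \<le> int n"
    using b(3,4)[of i j] b(3,4)[of i j'] b(3,4)[of i' j] b(3,4)[of i' j'] assms(2-5) by (simp add: abs_if)
qed

text \<open>A common chord would give A i' + B j = A i + B j' with i and i' different.\<close>

lemma sum_embedding_chords:
  assumes "sum_embedding p q n M A B" "chord A M w" "w \<noteq> 0"
  shows "\<not> chord B M w"
proof
  assume "chord B M w"
  then obtain i j i' j' where h: "i \<le> M" "i' \<le> M" "A i' - A i = w" "j \<le> M" "j' \<le> M" "B j' - B j = w"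
    using assms(2) unfolding chord_def by blast
  then have "A i' + B j = A i + B j'" by (simp add: diff_eq_eq add.commute add.left_commute)
  then have "i' = i" using sum_embedding_eq_iff[OF assms(1)] h by blast
  then show False using h assms(3) by simp
qed

text \<open>One representative of each pair of opposite moves.\<close>

definition leaper_lines :: "int \<Rightarrow> int \<Rightarrow> (int \<times> int) set" where
  "leaper_lines p q = {(p, q), (p, - q), (q, p), (q, - p)}"

lemma leaper_moves_lines:
  assumes "v \<in> leaper_moves p q"
  shows "\<exists>g\<in>leaper_lines p q. v = g \<or> v = - g"
proof -
  have "\<bar>fst v\<bar> = p \<and> \<bar>snd v\<bar> = q \<or> \<bar>fst v\<bar> = q \<and> \<bar>snd v\<bar> = p"
    using assms by (auto simp: leaper_moves_def doubleton_eq_iff)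
  then have "(fst v = p \<or> fst v = - p) \<and> (snd v = q \<or> snd v = - q)
      \<or> (fst v = q \<or> fst v = - q) \<and> (snd v = p \<or> snd v = - p)" by linarith
  then show ?thesis by (cases v) (auto simp: leaper_lines_def)
qed

text \<open>For each of the three splittings into pairs the two determinants agree in absolute
  value: 2 p q, |p^2 - q^2| or p^2 + q^2. These are nonzero as p and q are distinct and positive,
  and even as both are odd.\<close>

lemma leaper_lines_det:
  assumes "0 < p" "0 < q" "p \<noteq> q" "odd p" "odd q"
    and "leaper_lines p q = {g, g', h, h'}" "g \<noteq> g'" "h \<noteq> h'" "g \<noteq> h" "g \<noteq> h'" "g' \<noteq> h" "g' \<noteq> h'"
  shows "\<exists>N. N \<noteq> 0 \<and> \<bar>fst g * snd g' - fst g' * snd g\<bar> = 2 * N \<and> \<bar>fst h * snd h' - fst h' * snd h\<bar> = 2 * N"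
proof -
  have mem: "g \<in> {(p, q), (p, - q), (q, p), (q, - p)}" "g' \<in> {(p, q), (p, - q), (q, p), (q, - p)}"
     "h \<in> {(p, q), (p, - q), (q, p), (q, - p)}" "h' \<in> {(p, q), (p, - q), (q, p), (q, - p)}"
    using assms(6) unfolding leaper_lines_def by blast+
  define D where "D = \<bar>fst g * snd g' - fst g' * snd g\<bar>"
  have D_h: "D = \<bar>fst h * snd h' - fst h' * snd h\<bar>"
    using mem assms(7-12) unfolding D_def by (elim insertE emptyE) (simp_all add: algebra_simps abs_minus_commute)
  have "D \<noteq> 0"
  proof -
    have pos: "0 < p * q" "0 < p * p" "0 < q * q" "p * p \<noteq> q * q" "q * p = p * q"
      using assms(1-3) by (simp_all add: square_eq_iff)
    have "fst g * snd g' - fst g' * snd g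
        \<in> {2 * (p * q), - 2 * (p * q), p * p - q * q, q * q - p * p, p * p + q * q, - (p * p) - q * q}"
      using mem(1,2) assms(7) by (elim insertE emptyE) (simp_all add: algebra_simps)
    then have "fst g * snd g' - fst g' * snd g \<noteq> 0" using pos by (elim insertE emptyE) linarith+
    then show ?thesis by (simp add: D_def)
  qed
  have "even D" unfolding D_def using mem(1,2) assms(4,5) by (elim insertE emptyE) simp_all
  then obtain N where N: "D = 2 * N" by (rule evenE)
  show ?thesis
  proof (intro exI conjI)
    show "N \<noteq> 0" using N \<open>D \<noteq> 0\<close> by simp
    show "\<bar>fst g * snd g' - fst g' * snd g\<bar> = 2 * N" using N by (simp only: D_def)
    show "\<bar>fst h * snd h' - fst h' * snd h\<bar> = 2 * N" using N D_h by simp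
  qed
qed

text \<open>Each of (N, N) and (N, -N) is missing from \<open>A\<close> or from \<open>B\<close>. If
  one walk misses both, |x - y| + |x + y| is twice the larger of |x| and |y|, so at most 2 n. If the
  walks miss different ones, the triangle inequality and the width bounds in both coordinates again
  give 2 n.\<close>

lemma two_directions_bound:
  fixes g g' h h' :: "int \<times> int"
  assumes odd: "odd (fst g)" "odd (snd g)" "odd (fst g')" "odd (snd g')"
      "odd (fst h)" "odd (snd h)" "odd (fst h')" "odd (snd h')"
    and ne: "\<bar>fst g'\<bar> \<noteq> \<bar>snd g'\<bar>" "\<bar>fst h'\<bar> \<noteq> \<bar>snd h'\<bar>" and "N \<noteq> 0"
    and N: "\<bar>fst g * snd g' - fst g' * snd g\<bar> = 2 * N" "\<bar>fst h * snd h' - fst h' * snd h\<bar> = 2 * N"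
  shows "\<exists>C. \<forall>n M A B. sum_embedding p q n M A B \<longrightarrow> (\<forall>i<M. A (Suc i) - A i \<in> {g, - g, g', - g'}) \<longrightarrow>
    (\<forall>i<M. B (Suc i) - B i \<in> {h, - h, h', - h'}) \<longrightarrow> 4 * int M - 2 * int n \<le> C"
proof -
  note A_len = two_direction_length[OF odd(1-4) ne(1) N(1), unfolded prod.collapse]
  note B_len = two_direction_length[OF odd(5-8) ne(2) N(2), unfolded prod.collapse]
  from A_len obtain CA where CA: "\<And>A M. (\<forall>i<M. A (Suc i) - A i \<in> {g, - g, g', - g'}) \<Longrightarrow> inj_on A {..M} \<Longrightarrow>
    (\<not> chord A M (N, N) \<longrightarrow> (\<exists>i\<le>M. \<exists>j\<le>M. 2 * int M \<le> \<bar>fst (A j - A i) - snd (A j - A i)\<bar> + CA)) \<and>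
    (\<not> chord A M (N, - N) \<longrightarrow> (\<exists>i\<le>M. \<exists>j\<le>M. 2 * int M \<le> \<bar>fst (A j - A i) + snd (A j - A i)\<bar> + CA)) \<and>
    (\<not> chord A M (N, N) \<longrightarrow> \<not> chord A M (N, - N) \<longrightarrow>
      (\<exists>i\<le>M. \<exists>j\<le>M. 4 * int M \<le> \<bar>fst (A j - A i) - snd (A j - A i)\<bar> + \<bar>fst (A j - A i) + snd (A j - A i)\<bar> + CA))"
    by blast
  from B_len obtain CB where CB: "\<And>A M. (\<forall>i<M. A (Suc i) - A i \<in> {h, - h, h', - h'}) \<Longrightarrow> inj_on A {..M} \<Longrightarrow>
    (\<not> chord A M (N, N) \<longrightarrow> (\<exists>i\<le>M. \<exists>j\<le>M. 2 * int M \<le> \<bar>fst (A j - A i) - snd (A j - A i)\<bar> + CB)) \<and>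
    (\<not> chord A M (N, - N) \<longrightarrow> (\<exists>i\<le>M. \<exists>j\<le>M. 2 * int M \<le> \<bar>fst (A j - A i) + snd (A j - A i)\<bar> + CB)) \<and>
    (\<not> chord A M (N, N) \<longrightarrow> \<not> chord A M (N, - N) \<longrightarrow>
      (\<exists>i\<le>M. \<exists>j\<le>M. 4 * int M \<le> \<bar>fst (A j - A i) - snd (A j - A i)\<bar> + \<bar>fst (A j - A i) + snd (A j - A i)\<bar> + CB))"
    by blast
  have "4 * int M - 2 * int n \<le> \<bar>CA\<bar> + \<bar>CB\<bar>"
    if emb: "sum_embedding p q n M A B"
      and A: "\<forall>i<M. A (Suc i) - A i \<in> {g, - g, g', - g'}"
      and B: "\<forall>i<M. B (Suc i) - B i \<in> {h, - h, h', - h'}" for n M A B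
  proof -
    have inj: "inj_on A {..M}" "inj_on B {..M}"
      using sum_embedding_inj emb sum_embedding_commute by blast+
    note lenA = CA[OF A inj(1)] and lenB = CB[OF B inj(2)]
    note widthA = sum_embedding_width[OF emb] and widthB = sum_embedding_width[OF sum_embedding_commute[OF emb]]
    have ws: "(N, N) \<noteq> 0" "(N, - N) \<noteq> 0" using \<open>N \<noteq> 0\<close> by (simp_all add: zero_prod_def)
    consider "\<not> chord A M (N, N)" "\<not> chord A M (N, - N)" | "\<not> chord A M (N, N)" "\<not> chord B M (N, - N)"
      | "\<not> chord B M (N, N)" "\<not> chord A M (N, - N)" | "\<not> chord B M (N, N)" "\<not> chord B M (N, - N)"
      using sum_embedding_chords[OF emb _ ws(1)] sum_embedding_chords[OF emb _ ws(2)] by blast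
    then show ?thesis
    proof cases
      case 1
      then obtain i j where ij: "i \<le> M" "j \<le> M"
        "4 * int M \<le> \<bar>fst (A j - A i) - snd (A j - A i)\<bar> + \<bar>fst (A j - A i) + snd (A j - A i)\<bar> + CA"
        using lenA by blast
      then show ?thesis using widthA[OF ij(1,2), of 0 0] by linarith
    next
      case 2
      obtain i j where ij: "i \<le> M" "j \<le> M" "2 * int M \<le> \<bar>fst (A j - A i) - snd (A j - A i)\<bar> + CA"
        using lenA 2 by blast
      obtain i' j' where ij': "i' \<le> M" "j' \<le> M" "2 * int M \<le> \<bar>fst (B j' - B i') + snd (B j' - B i')\<bar> + CB"
        using lenB 2 by blast
      show ?thesis using widthA[OF ij(1,2) ij'(1,2)] ij(3) ij'(3) by linarith
    next
      case 3
      obtain i j where ij: "i \<le> M" "j \<le> M" "2 * int M \<le> \<bar>fst (A j - A i) + snd (A j - A i)\<bar> + CA"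
        using lenA 3 by blast
      obtain i' j' where ij': "i' \<le> M" "j' \<le> M" "2 * int M \<le> \<bar>fst (B j' - B i') - snd (B j' - B i')\<bar> + CB"
        using lenB 3 by blast
      show ?thesis using widthA[OF ij(1,2) ij'(1,2)] ij(3) ij'(3) by linarith
    next
      case 4
      then obtain i j where ij: "i \<le> M" "j \<le> M"
        "4 * int M \<le> \<bar>fst (B j - B i) - snd (B j - B i)\<bar> + \<bar>fst (B j - B i) + snd (B j - B i)\<bar> + CB"
        using lenB by blast
      then show ?thesis using widthB[OF ij(1,2), of 0 0] by linarith
    qed
  qed
  then show ?thesis by blast
qed

lemma finite_uniform_bound:
  fixes v :: "'b \<Rightarrow> int"
  assumes "finite T" and "\<And>x. x \<in> T \<Longrightarrow> \<exists>C. \<forall>y. P x y \<longrightarrow> v y \<le> C"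
  shows "\<exists>C. \<forall>x\<in>T. \<forall>y. P x y \<longrightarrow> v y \<le> C"
  using assms
proof (induction T)
  case (insert x T)
  then obtain C C' where "\<forall>x\<in>T. \<forall>y. P x y \<longrightarrow> v y \<le> C" "\<forall>y. P x y \<longrightarrow> v y \<le> C'" by blast
  then show ?case by (intro exI[of _ "max C C'"]) (auto simp: le_max_iff_disj)
qed simp

text \<open>One of two distinct odd positive numbers is at least 3, so a straight walk already needs
  3 M <= n.\<close>

lemma straight_bound:
  assumes emb: "sum_embedding p q n M A B" and A: "\<forall>i<M. A (Suc i) - A i \<in> {e, - e}"
    and e: "e \<in> leaper_lines p q" and pq: "0 < p" "0 < q" "p \<noteq> q" "odd p" "odd q"
  shows "4 * int M - 2 * int n \<le> 0"
proof -
  have "3 \<le> \<bar>fst e\<bar> \<or> 3 \<le> \<bar>snd e\<bar>"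
  proof -
    have "p \<noteq> 2" "q \<noteq> 2" using pq by auto
    then have "3 \<le> p \<or> 3 \<le> q" using pq by linarith
    then show ?thesis using e pq by (auto simp: leaper_lines_def)
  qed
  then have "int M * 3 \<le> int M * \<bar>fst e\<bar> \<or> int M * 3 \<le> int M * \<bar>snd e\<bar>"
    by (meson mult_left_mono of_nat_0_le_iff)
  then have "int M * 3 \<le> int n"
    using straight_length[of M A e] A sum_embedding_inj[OF emb] sum_embedding_width[OF emb, of 0 M 0 0]
    by auto
  then show ?thesis by simp
qed

lemma embedding_upper_bound:
  assumes pq: "0 < p" "0 < q" "p \<noteq> q" "odd p" "odd q"
  shows "\<exists>C. \<forall>n M. embeds_into (grid_graph (Suc M)) (leaper_graph p q n) \<longrightarrow> 4 * int M - 2 * int n \<le> C"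
proof -
  define S where "S = leaper_lines p q"
  have "finite S" by (simp add: S_def leaper_lines_def)
  \<comment> \<open>Finitely many splittings of the directions occur, so their constants can be
    merged into one.\<close>
  define T where "T = {(g, g', h, h'). g \<in> S \<and> g' \<in> S \<and> h \<in> S \<and> h' \<in> S \<and> (\<exists>N. N \<noteq> 0 \<and>
    \<bar>fst g * snd g' - fst g' * snd g\<bar> = 2 * N \<and> \<bar>fst h * snd h' - fst h' * snd h\<bar> = 2 * N)}"
  have "finite T" by (rule finite_subset[of _ "S \<times> S \<times> S \<times> S"]) (auto simp: T_def \<open>finite S\<close>)
  define R where "R = (\<lambda>(g, g', h, h') (n, M, A, B). sum_embedding p q n M A B \<and>
    (\<forall>i<M. A (Suc i) - A i \<in> {g, - g, g', - g'}) \<and> (\<forall>i<M. B (Suc i) - B i \<in> {h, - h, h', - h'}))"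
  have S: "odd (fst g) \<and> odd (snd g) \<and> \<bar>fst g\<bar> \<noteq> \<bar>snd g\<bar>" if "g \<in> S" for g
    using that pq by (auto simp: S_def leaper_lines_def)
  have bound: "\<exists>C. \<forall>y. R x y \<longrightarrow> (case y of (n, M, A, B) \<Rightarrow> 4 * int M - 2 * int n) \<le> C" if xT: "x \<in> T" for x
  proof -
    obtain g g' h h' where x: "x = (g, g', h, h')" by (metis prod.exhaust)
    obtain N where N: "N \<noteq> 0" "\<bar>fst g * snd g' - fst g' * snd g\<bar> = 2 * N" "\<bar>fst h * snd h' - fst h' * snd h\<bar> = 2 * N"
      and mem: "g \<in> S" "g' \<in> S" "h \<in> S" "h' \<in> S"
      using xT by (auto simp: x T_def)
    obtain C where "\<And>n M A B. sum_embedding p q n M A B \<Longrightarrow> (\<forall>i<M. A (Suc i) - A i \<in> {g, - g, g', - g'}) \<Longrightarrow>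
      (\<forall>i<M. B (Suc i) - B i \<in> {h, - h, h', - h'}) \<Longrightarrow> 4 * int M - 2 * int n \<le> C"
      using two_directions_bound[of g g' h h' N p q] S[OF mem(1)] S[OF mem(2)] S[OF mem(3)] S[OF mem(4)] N
      by blast
    then show ?thesis by (intro exI[of _ C]) (auto simp: R_def x)
  qed
  have "\<exists>C. \<forall>x\<in>T. \<forall>y. R x y \<longrightarrow> (case y of (n, M, A, B) \<Rightarrow> 4 * int M - 2 * int n) \<le> C"
    by (rule finite_uniform_bound[OF \<open>finite T\<close>]) (rule bound)
  then obtain C
    where C: "\<And>x y. x \<in> T \<Longrightarrow> R x y \<Longrightarrow> (case y of (n, M, A, B) \<Rightarrow> 4 * int M - 2 * int n) \<le> C" by blast
  have "4 * int M - 2 * int n \<le> \<bar>C\<bar>" if "embeds_into (grid_graph (Suc M)) (leaper_graph p q n)" for n M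
  proof -
    obtain A B where emb: "sum_embedding p q n M A B" using embeds_imp_sum_embedding[OF \<open>embeds_into _ _\<close>] by blast
    define SA where "SA = {g \<in> S. \<exists>i<M. A (Suc i) - A i = g \<or> A (Suc i) - A i = - g}"
    define SB where "SB = {g \<in> S. \<exists>i<M. B (Suc i) - B i = g \<or> B (Suc i) - B i = - g}"
    have inA: "\<exists>g\<in>SA. A (Suc i) - A i = g \<or> A (Suc i) - A i = - g" if "i < M" for i
      using that emb leaper_moves_lines[of "A (Suc i) - A i" p q]
      unfolding SA_def S_def sum_embedding_def by blast
    have inB: "\<exists>g\<in>SB. B (Suc i) - B i = g \<or> B (Suc i) - B i = - g" if "i < M" for i
      using that emb leaper_moves_lines[of "B (Suc i) - B i" p q]
      unfolding SB_def S_def sum_embedding_def by blast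
    \<comment> \<open>A direction shared by both walks makes two sums coincide: opposite corners of
      a unit square if the steps are equal or opposite.\<close>
    have disj: "SA \<inter> SB = {}"
    proof (rule ccontr)
      assume "SA \<inter> SB \<noteq> {}"
      then obtain g i j where ij: "i < M" "j < M" "A (Suc i) - A i = g \<or> A (Suc i) - A i = - g"
        "B (Suc j) - B j = g \<or> B (Suc j) - B j = - g" unfolding SA_def SB_def by blast
      then consider "A (Suc i) - A i = B (Suc j) - B j" | "A (Suc i) - A i = - (B (Suc j) - B j)"
        by (metis minus_minus)
      then show False
      proof cases
        case 1
        then have "A (Suc i) + B j = A i + B (Suc j)" by (simp add: algebra_simps)
        then show ?thesis using sum_embedding_eq_iff[OF emb, of "Suc i" j i "Suc j"] ij by simp
      next
        case 2
        then have "A (Suc i) + B (Suc j) = A i + B j" by (simp add: algebra_simps)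
        then show ?thesis using sum_embedding_eq_iff[OF emb, of "Suc i" "Suc j" i j] ij by simp
      qed
    qed
    consider (A) e where "e \<in> S" "SA \<subseteq> {e}" | (B) e where "e \<in> S" "SB \<subseteq> {e}"
      | (AB) g g' h h' where "g \<in> SA" "g' \<in> SA" "g \<noteq> g'" "h \<in> SB" "h' \<in> SB" "h \<noteq> h'"
    proof -
      have "S \<noteq> {}" by (simp add: S_def leaper_lines_def)
      have "(\<exists>e\<in>S. X \<subseteq> {e}) \<or> (\<exists>g\<in>X. \<exists>g'\<in>X. g \<noteq> g')" if "X \<subseteq> S" for X
        using that \<open>S \<noteq> {}\<close> by blast
      from this[of SA] this[of SB] show ?thesis using that unfolding SA_def SB_def by blast
    qed
    then show ?thesis
    proof cases
      case A
      then have "\<forall>i<M. A (Suc i) - A i \<in> {e, - e}" using inA by blast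
      from straight_bound[OF emb this _ pq] A show ?thesis by (simp add: S_def)
    next
      case B
      then have "\<forall>i<M. B (Suc i) - B i \<in> {e, - e}" using inB by blast
      from straight_bound[OF sum_embedding_commute[OF emb] this _ pq] B show ?thesis by (simp add: S_def)
    next
      case AB
      have ne: "g \<noteq> h" "g \<noteq> h'" "g' \<noteq> h" "g' \<noteq> h'" using AB disj by auto
      have mem: "g \<in> S" "g' \<in> S" "h \<in> S" "h' \<in> S" using AB by (auto simp: SA_def SB_def)
      have "card {g, g', h, h'} = 4" using AB ne by simp
      moreover have "card S \<le> 4"
      proof -
        have "S = set [(p, q), (p, - q), (q, p), (q, - p)]" by (simp add: S_def leaper_lines_def)
        then show ?thesis using card_length[of "[(p, q), (p, - q), (q, p), (q, - p)]"] by simp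
      qed
      ultimately have S_eq: "S = {g, g', h, h'}"
        using mem \<open>finite S\<close> by (intro card_seteq[symmetric]) auto
      have "(g, g', h, h') \<in> T"
        using leaper_lines_det[OF pq S_eq[unfolded S_def] AB(3,6) ne] mem by (simp add: T_def)
      moreover have "SA \<subseteq> {g, g'}" "SB \<subseteq> {h, h'}"
        using S_eq disj AB unfolding SA_def SB_def by blast+
      then have "\<forall>i<M. A (Suc i) - A i \<in> {g, - g, g', - g'}" "\<forall>i<M. B (Suc i) - B i \<in> {h, - h, h', - h'}"
        using inA inB by blast+
      then have "R (g, g', h, h') (n, M, A, B)" using emb by (simp add: R_def)
      ultimately have "4 * int M - 2 * int n \<le> C" using C by fastforce
      then show ?thesis by simp
    qed
  qed
  then show ?thesis by blast
qed

subsection \<open>The lower bound\<close>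

definition snake :: "nat \<Rightarrow> nat \<Rightarrow> int \<times> int" where
  "snake a i = (if even (i div a) then int (i mod a) else int a - 1 - int (i mod a), int (i div a))"

lemma snake_fst:
  assumes "0 < a"
  shows "0 \<le> fst (snake a i)" "fst (snake a i) \<le> int a - 1"
  using mod_less_divisor[OF assms, of i] by (auto simp: snake_def)

lemma snake_snd: "0 \<le> snd (snake a i)" "i \<le> M \<Longrightarrow> snd (snake a i) \<le> int (M div a)"
  by (simp_all add: snake_def div_le_mono)

lemma snake_inj: "snake a i = snake a j \<Longrightarrow> i = j"
proof -
  assume "snake a i = snake a j"
  then have "i div a = j div a" "i mod a = j mod a" by (auto simp: snake_def split: if_splits)
  then show "i = j" by (metis div_mult_mod_eq)
qed

text \<open>Rows alternate in direction, so each one ends in the column where the next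
  begins.\<close>

lemma snake_step:
  assumes "0 < a"
  shows "snake a (Suc i) - snake a i \<in> {(1, 0), (- 1, 0), (0, 1)}"
proof (cases "Suc (i mod a) = a")
  case True
  then have "Suc i mod a = 0" "Suc i div a = Suc (i div a)" by (simp_all add: mod_Suc div_Suc)
  moreover have "int (i mod a) = int a - 1" using True by linarith
  ultimately show ?thesis by (auto simp: snake_def)
next
  case False
  then have "Suc i mod a = Suc (i mod a)" "Suc i div a = i div a" by (simp_all add: mod_Suc div_Suc)
  then show ?thesis by (auto simp: snake_def)
qed

text \<open>Coprimality gives 2 s = q k + p l and 2 s' = q l - p k. Their squares sum to (p^2 + q^2)
  (k^2 + l^2), which the width condition keeps below 4 (p^2 + q^2). So |k| and |l| are at most
  1.\<close>

lemma snakes_independent: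
  fixes p q s t s' t' :: int
  assumes pq: "0 < p" "0 < q" "odd p" "odd q" "coprime p q"
    and x: "p * (s + t) + q * (s' + t') = 0" and y: "q * (s - t) - p * (s' - t') = 0"
    and s: "2 * \<bar>s\<bar> < p + q" "2 * \<bar>s'\<bar> < p + q"
  shows "s = 0 \<and> t = 0 \<and> s' = 0 \<and> t' = 0"
proof -
  have "q dvd p * (s + t)" using x by (metis add.commute dvd_add_right_iff dvd_triv_left dvd_0_right)
  then have "q dvd s + t" using pq(5) by (metis coprime_commute coprime_dvd_mult_right_iff)
  then obtain k where k: "s + t = q * k" ..
  have "p dvd q * (s - t)" using y by (simp add: diff_eq_eq)
  then have "p dvd s - t" using pq(5) by (metis coprime_dvd_mult_right_iff)
  then obtain l where l: "s - t = p * l" ..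
  have "q * (p * k + (s' + t')) = 0" using x unfolding k by (simp add: algebra_simps)
  then have k': "s' + t' = - p * k" using pq(2) by auto
  have "p * (q * l - (s' - t')) = 0" using y unfolding l by (simp add: algebra_simps)
  then have l': "s' - t' = q * l" using pq(1) by simp
  have X: "2 * s = q * k + p * l" and Y: "2 * s' = q * l - p * k" using k l k' l' by auto
  have "even (q * k + p * l)" using X[symmetric] by simp
  then have par: "even k \<longleftrightarrow> even l" using pq by simp
  have sq: "(2 * z)\<^sup>2 < (p + q)\<^sup>2" if "2 * \<bar>z\<bar> < p + q" for z
  proof -
    have "\<not> \<bar>p + q\<bar> \<le> \<bar>2 * z\<bar>" using that by simp
    then show ?thesis unfolding abs_le_square_iff by simp
  qed
  have "(p\<^sup>2 + q\<^sup>2) * (k\<^sup>2 + l\<^sup>2) = (2 * s)\<^sup>2 + (2 * s')\<^sup>2"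
    unfolding X Y by (simp add: power2_eq_square algebra_simps)
  also have "\<dots> < 2 * (p + q)\<^sup>2" using sq[OF s(1)] sq[OF s(2)] by simp
  also have "2 * (p + q)\<^sup>2 \<le> 2 * (p + q)\<^sup>2 + 2 * (p - q)\<^sup>2" by simp
  also have "\<dots> = (p\<^sup>2 + q\<^sup>2) * 4" by (simp add: power2_eq_square algebra_simps)
  finally have "(p\<^sup>2 + q\<^sup>2) * (k\<^sup>2 + l\<^sup>2) < (p\<^sup>2 + q\<^sup>2) * 4" .
  moreover have "0 < p\<^sup>2 + q\<^sup>2" using pq(1,2) by (simp add: add_pos_pos)
  ultimately have "k\<^sup>2 + l\<^sup>2 < 4" using mult_less_cancel_left_pos by blast
  then have lt: "k\<^sup>2 < 4" "l\<^sup>2 < 4" using zero_le_power2[of k] zero_le_power2[of l] by linarith+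
  have "\<bar>k\<bar> < 2" "\<bar>l\<bar> < 2"
    using lt abs_le_square_iff[of 2 k] abs_le_square_iff[of 2 l] by simp_all
  then have kl: "k \<in> {- 1, 0, 1}" "l \<in> {- 1, 0, 1}" by auto
  \<comment> \<open>By parity, otherwise k and l are both 1 or -1; then 2 s or 2 s' equals p + q up
    to sign, which is too large.\<close>
  have "k = 0 \<and> l = 0"
    using kl par s X Y by auto
  then show ?thesis using X Y k k' by auto
qed

text \<open>Width (p + q) / 2 is just small enough for \<open>snakes_independent\<close>. Sweeping M
  div a further rows costs (p + q) (M div a) <= 2 M in each coordinate; the remaining extent depends
  only on p and q.\<close>

lemma snake_embedding:
  fixes p q :: int
  assumes pq: "0 < p" "0 < q" "odd p" "odd q" "coprime p q"
    and n: "2 * int M + (p + q) * (p + q) + 1 \<le> int n"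
  shows "embeds_into (grid_graph (Suc M)) (leaper_graph p q n)"
proof (rule sum_embedding_imp_embeds)
  define a where "a = nat ((p + q) div 2)"
  have a: "2 * int a = p + q" "0 < a" using pq by (auto simp: a_def)
  define T where "T = int (M div a)"
  \<comment> \<open>The additive constants shift the least possible value of each coordinate of the
    sum to 1.\<close>
  define A where "A i = (p * (fst (snake a i) + snd (snake a i)) + 1,
    q * (fst (snake a i) - snd (snake a i)) + (1 + q * T + p * (int a - 1)))" for i
  define B where "B j = (q * (fst (snake a j) + snd (snake a j)), - (p * (fst (snake a j) - snd (snake a j))))" for j
  have T: "(p + q) * T \<le> 2 * int M"
  proof -
    have "int a * T \<le> int M" unfolding T_def by (metis mult.commute div_times_less_eq_dividend of_nat_le_iff of_nat_mult)
    then show ?thesis using a(1)[symmetric] by simp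
  qed
  have aa: "(p + q) * (int a - 1) \<le> (p + q) * (p + q)" using pq a by (intro mult_left_mono) auto
  have moves: "(d, e) \<in> leaper_moves p q" if "\<bar>d\<bar> = p \<and> \<bar>e\<bar> = q \<or> \<bar>d\<bar> = q \<and> \<bar>e\<bar> = p" for d e
    using that by (auto simp: leaper_moves_def)
  show "sum_embedding p q n M A B"
    unfolding sum_embedding_def
  proof (intro conjI allI impI)
    fix i assume "i < M"
    obtain d e where de: "snake a (Suc i) - snake a i = (d, e)" "(d, e) \<in> {(1, 0), (- 1, 0), (0, 1)}"
      using snake_step[OF a(2), of i] by (metis prod.exhaust)
    then have f: "fst (snake a (Suc i)) = fst (snake a i) + d" "snd (snake a (Suc i)) = snd (snake a i) + e"
      by (auto simp: prod_eq_iff)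
    have "A (Suc i) - A i = (p * (d + e), q * (d - e))" "B (Suc i) - B i = (q * (d + e), - (p * (d - e)))"
      unfolding A_def B_def f by (simp_all add: algebra_simps)
    then show "A (Suc i) - A i \<in> leaper_moves p q" "B (Suc i) - B i \<in> leaper_moves p q"
      using de(2) pq by (auto intro!: moves)
  next
    fix i j assume ij: "i \<le> M" "j \<le> M"
    define s t s' t' where "s = fst (snake a i)" and "t = snd (snake a i)"
      and "s' = fst (snake a j)" and "t' = snd (snake a j)"
    have b: "0 \<le> s" "s \<le> int a - 1" "0 \<le> t" "t \<le> T" "0 \<le> s'" "s' \<le> int a - 1" "0 \<le> t'" "t' \<le> T"
      using snake_fst[OF a(2)] snake_snd ij unfolding s_def t_def s'_def t'_def T_def by auto
    have P: "0 \<le> p * z" "p * z \<le> p * z'" and Q: "0 \<le> q * z" "q * z \<le> q * z'" if "0 \<le> z" "z \<le> z'" for z z'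
      using that pq by (auto intro: mult_left_mono)
    have e: "A i + B j = (p * s + p * t + q * s' + q * t' + 1,
        q * s - q * t - p * s' + p * t' + (1 + q * T + p * (int a - 1)))"
      unfolding A_def B_def s_def t_def s'_def t'_def by (simp add: algebra_simps)
    have n2: "p * T + q * T + (p * (int a - 1) + q * (int a - 1)) + 1 \<le> int n"
      using n T aa by (simp add: distrib_right)
    show "A i + B j \<in> board n"
      unfolding e board_def mem_Times_iff fst_conv snd_conv atLeastAtMost_iff
      using P[OF b(1,2)] P[OF b(3,4)] P[OF b(5,6)] P[OF b(7,8)] Q[OF b(1,2)] Q[OF b(3,4)] Q[OF b(5,6)] Q[OF b(7,8)] n2
      by linarith
  next
    show "inj_on (\<lambda>(i, j). A i + B j) ({..M} \<times> {..M})"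
    proof (rule inj_on_pairI)
      fix i j i' j' assume eq: "A i + B j = A i' + B j'"
      define s t s' t' where "s = fst (snake a i) - fst (snake a i')" and "t = snd (snake a i) - snd (snake a i')"
        and "s' = fst (snake a j) - fst (snake a j')" and "t' = snd (snake a j) - snd (snake a j')"
      have "s = 0 \<and> t = 0 \<and> s' = 0 \<and> t' = 0"
      proof (rule snakes_independent[OF pq])
        show "p * (s + t) + q * (s' + t') = 0" "q * (s - t) - p * (s' - t') = 0"
          using eq unfolding A_def B_def s_def t_def s'_def t'_def by (simp_all add: algebra_simps)
        have "\<bar>s\<bar> \<le> int a - 1"
          using snake_fst[OF a(2), of i] snake_fst[OF a(2), of i'] by (simp add: s_def abs_le_iff)
        then show "2 * \<bar>s\<bar> < p + q" using a(1) by linarith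
        have "\<bar>s'\<bar> \<le> int a - 1"
          using snake_fst[OF a(2), of j] snake_fst[OF a(2), of j'] by (simp add: s'_def abs_le_iff)
        then show "2 * \<bar>s'\<bar> < p + q" using a(1) by linarith
      qed
      then have "snake a i = snake a i'" "snake a j = snake a j'"
        by (simp_all add: s_def t_def s'_def t'_def prod_eq_iff)
      then show "i = i' \<and> j = j'" using snake_inj by blast
    qed
  qed
qed

theorem theorem2:
  fixes p q :: int
  assumes "0 < p" and "0 < q" and "p \<noteq> q" and "odd p" and "odd q" and "gcd p q = 1"
  shows "\<exists>C::real. \<forall>n::nat. n \<ge> 1 \<longrightarrow> \<bar>real (max_grid p q n) - real n / 2\<bar> \<le> C"
proof -
  obtain C where C: "\<And>n M. embeds_into (grid_graph (Suc M)) (leaper_graph p q n) \<Longrightarrow> 4 * int M - 2 * int n \<le> C"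
    using embedding_upper_bound[OF assms(1-5)] by blast
  define D where "D = nat ((p + q) * (p + q) + 1)"
  have D: "int D = (p + q) * (p + q) + 1" using assms(1,2) by (simp add: D_def)
  have "coprime p q" using assms(6) by (simp add: coprime_iff_gcd_eq_1)
  have "\<bar>real (max_grid p q n) - real n / 2\<bar> \<le> \<bar>real_of_int C\<bar> + 1 + real D" if "n \<ge> 1" for n
  proof -
    note max = max_grid_greatest[where p = p and q = q, OF that]
    obtain M where M: "max_grid p q n = Suc M" using max(1) by (metis Suc_le_D One_nat_def)
    have "4 * int M - 2 * int n \<le> C" using C max(2) unfolding M by blast
    then have "real_of_int (4 * int M - 2 * int n) \<le> real_of_int C" by (simp only: of_int_le_iff)
    then have upper: "real M - real n / 2 \<le> \<bar>real_of_int C\<bar>" by simp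
    have lower: "n \<le> 2 * M + 2 + D"
    proof (cases "D \<le> n")
      case True
      \<comment> \<open>The largest K with 2 K + D <= n, so that the snake construction
        applies.\<close>
      define K where "K = (n - D) div 2"
      have K: "2 * K \<le> n - D" "n - D < 2 * K + 2" unfolding K_def by presburger+
      then have "2 * int K + (p + q) * (p + q) + 1 \<le> int n" using True D by linarith
      from snake_embedding[OF assms(1,2,4,5) \<open>coprime p q\<close> this]
      have "K \<le> M" using max(3)[of "Suc K"] unfolding M by simp
      then show ?thesis using True K by arith
    qed simp
    have "real n \<le> real (2 * M + 2 + D)" using lower by (simp only: of_nat_le_iff)
    then have "real n \<le> 2 * (real M + 1) + real D" by simp
    then show ?thesis unfolding M using upper by (simp add: abs_le_iff)
  qed
  then show ?thesis by blast
qed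

end
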